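(* Let $p\in\mathbb{K}[X,Y]\setminus(\mathbb{K}[X]\cup\mathbb{K}[Y])$ be such that $p(0)=0$. Let $I=\langle p\rangle\subseteq\mathbb{K}[X,Y]$, let $P=\phi(p)$, and let $\bar I=\langle P\rangle$ be the ideal generated by $P$ in $\mathbb{K}(X,Y)[s,t]$. Suppose that $A(\bar I)$ is not trivial, and let $(F,G)\in\mathbb{K}(X,Y)[s]\times\mathbb{K}(X,Y)[t]$ be a generator of the $\mathbb{K}(X,Y)$-algebra $A(\bar I)$ such that $F$ and $G$ have no denominator (i.e., $F\in\mathbb{K}[X,Y][s]$ and $G\in\mathbb{K}[X,Y][t]$), $F-G$ has no factor in $\mathbb{K}[X,Y]$, and $F|_{s=0}=G|_{t=0}=0$. Then $A(I)$ is nontrivial if and only if $F\in\mathbb{K}[X][s]$ and $G\in\mathbb{K}[Y][t]$ and $F|_{s=1}\neq G|_{t=1}$. In this case, $(F|_{s=1},G|_{t=1})$ is a generator of the $\mathbb{K}$-algebra $A(I)$.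
   Context: $\mathbb{K}$ is a computable field of characteristic zero in which one can decide whether a given element is a root of unity. $X$ stands for the variables $x_1,\dots,x_n$ and $Y$ for $y_1,\dots,y_m$ ($n,m\ge 1$). For an ideal $I\subseteq\mathbb{K}[X,Y]$, $A(I):=\{(f,g)\in\mathbb{K}[X]\times\mathbb{K}[Y] : f-g\in I\}$, which is a unital $\mathbb{K}$-algebra with component-wise operations and unit $(1,1)$. Likewise, for an ideal $\bar I\subseteq\mathbb{K}(X,Y)[s,t]$ (a polynomial ring in the two variables $s,t$ over the field $\mathbb{K}(X,Y)$), $A(\bar I):=\{(F,G)\in\mathbb{K}(X,Y)[s]\times\mathbb{K}(X,Y)[t] : F-G\in\bar I\}$, a unital $\mathbb{K}(X,Y)$-algebra. Such an algebra is called trivial if it consists only of the multiples of $(1,1)$ by elements of the ground field ($\mathbb{K}$, respectively $\mathbb{K}(X,Y)$). An element is a generator of such an algebra if every element of the algebra is a polynomial in it with coefficients in the ground field (constants standing for multiples of $(1,1)$). $\phi\colon\mathbb{K}[X,Y]\to\mathbb{K}(X,Y)[s,t]$ is the ring homomorphism fixing $\mathbb{K}$ that maps each $x_i$ to $sx_i$ and each $y_j$ to $ty_j$. "Has no factor in $\mathbb{K}[X,Y]$" means: is not divisible in $\mathbb{K}[X,Y][s,t]$ by any non-constant element of $\mathbb{K}[X,Y]$. *)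

theory Defs
  imports
    "HOL-Library.Poly_Mapping"
    "HOL-Computational_Algebra.Computational_Algebra"
begin

text \<open>
  The index type \<open>'v\<close> lists all variables; a statement splits it into two nonempty blocks
  \<open>X\<close> and \<open>Y\<close>. So \<open>('v, 'a) mpoly\<close> is \<open>K[X,Y]\<close>, and \<open>K[X]\<close>, \<open>K[Y]\<close> are subsets of it.
  A linear order on \<open>'v\<close> is only needed because the library's integral-domain instance for
  \<open>\<Rightarrow>\<^sub>0\<close> asks for one; nothing below depends on it.
\<close>

type_synonym ('v, 'a) mpoly = "('v \<Rightarrow>\<^sub>0 nat) \<Rightarrow>\<^sub>0 'a"

definition mconst :: "'a \<Rightarrow> ('v, 'a::zero) mpoly" where
  "mconst c = Poly_Mapping.single 0 c"

definition mvar :: "'v \<Rightarrow> ('v, 'a::zero_neq_one) mpoly" where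
  "mvar v = Poly_Mapping.single (Poly_Mapping.single v 1) 1"

definition polys_in :: "'v set \<Rightarrow> ('v, 'a::zero) mpoly set" where
  "polys_in V = {p. \<forall>m \<in> Poly_Mapping.keys p. Poly_Mapping.keys m \<subseteq> V}"

text \<open>The ring homomorphism that acts as \<open>\<iota>\<close> on constants and sends each variable \<open>v\<close> to \<open>\<sigma> v\<close>.\<close>

definition mpoly_eval ::
  "('a::zero \<Rightarrow> 'r::comm_semiring_1) \<Rightarrow> ('v \<Rightarrow> 'r) \<Rightarrow> ('v, 'a) mpoly \<Rightarrow> 'r" where
  "mpoly_eval \<iota> \<sigma> p = (\<Sum>m\<in>Poly_Mapping.keys p. \<iota> (Poly_Mapping.lookup p m) * (\<Prod>v\<in>Poly_Mapping.keys m. \<sigma> v ^ Poly_Mapping.lookup m v))"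

definition ideal_of :: "'r::comm_ring_1 set \<Rightarrow> 'r set" where
  "ideal_of S = module.span (*) S"

text \<open>
  \<open>R[s,t]\<close> is represented as \<open>R[s][t]\<close>: the inner polynomial variable is \<open>s\<close>, the outer one \<open>t\<close>.
  The next two definitions are the inclusions of \<open>R[s]\<close> and \<open>R[t]\<close>.
\<close>

definition in_s :: "'r::comm_semiring_1 poly \<Rightarrow> 'r poly poly" where
  "in_s F = [:F:]"

definition in_t :: "'r::comm_semiring_1 poly \<Rightarrow> 'r poly poly" where
  "in_t G = map_poly (\<lambda>c. [:c:]) G"

definition const_st :: "'r::comm_semiring_1 \<Rightarrow> 'r poly poly" where
  "const_st c = [:[:c:]:]"

definition phi ::
  "'v set \<Rightarrow> ('v::linorder, 'a::idom) mpoly \<Rightarrow> ('v, 'a) mpoly fract poly poly" where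
  "phi X = mpoly_eval (\<lambda>c. const_st (to_fract (mconst c)))
     (\<lambda>v. (if v \<in> X then in_s [:0, 1:] else in_t [:0, 1:]) * const_st (to_fract (mvar v)))"

definition alg_XY ::
  "'v set \<Rightarrow> 'v set \<Rightarrow> ('v, 'a::comm_ring_1) mpoly set
     \<Rightarrow> (('v, 'a) mpoly \<times> ('v, 'a) mpoly) set" where
  "alg_XY X Y I = {(f, g). f \<in> polys_in X \<and> g \<in> polys_in Y \<and> f - g \<in> I}"

definition alg_st :: "'k::comm_ring_1 poly poly set \<Rightarrow> ('k poly \<times> 'k poly) set" where
  "alg_st J = {(F, G). in_s F - in_t G \<in> J}"

text \<open>
  Algebras of pairs over a ground field \<open>'k\<close> embedded by \<open>\<iota>\<close> into each component; the operations
  are component-wise, so a univariate \<open>h\<close> over \<open>'k\<close> is evaluated at a pair in each component.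
\<close>

definition trivial_algebra :: "('k \<Rightarrow> 'r) \<Rightarrow> ('r \<times> 'r) set \<Rightarrow> bool" where
  "trivial_algebra \<iota> A \<longleftrightarrow> A \<subseteq> {(\<iota> c, \<iota> c) | c. True}"

definition generates_algebra ::
  "('k::zero \<Rightarrow> 'r::comm_ring_1) \<Rightarrow> ('r \<times> 'r) set \<Rightarrow> 'r \<times> 'r \<Rightarrow> bool" where
  "generates_algebra \<iota> A u \<longleftrightarrow> u \<in> A \<and>
     (\<forall>w\<in>A. \<exists>h :: 'k poly.
        w = (poly (map_poly \<iota> h) (fst u), poly (map_poly \<iota> h) (snd u)))"

end

theory Submission
  imports Defs
begin

text \<open>
  Write \<open>R = K[X,Y]\<close>. Setting \<open>s = t = 1\<close> turns \<open>P\<close> into \<open>p\<close>, so it must be seen that \<open>P\<close> divides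
  \<open>F - G\<close> over \<open>R\<close> and not just over its fraction field. Nontriviality of \<open>A(\<langle>P\<rangle>)\<close> forces \<open>P\<close> to have
  a nonzero coefficient in \<open>K[X]\<close> and one in \<open>K[Y]\<close>; dividing from either of these, the quotient has
  coefficients in \<open>R[1/u]\<close> with \<open>u \<in> K[X]\<close> and in \<open>R[1/v]\<close> with \<open>v \<in> K[Y]\<close>, hence in \<open>R\<close>.

  Conversely, a nonconstant \<open>(f, g) \<in> A(I)\<close> homogenizes to \<open>(h(F), h(G))\<close> for some \<open>h\<close>. Comparing
  leading coefficients, the \<open>k\<close>-th power of \<open>lc F / lc G\<close> is a quotient of an element of \<open>K[X]\<close> by one
  of \<open>K[Y]\<close>, so \<open>lc F = r \<gamma>\<close> and \<open>lc G = q \<gamma>\<close> with \<open>r \<in> K[X]\<close>, \<open>q \<in> K[Y]\<close>. The coefficients of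
  \<open>F / \<gamma>\<close> and \<open>h(\<gamma> z)\<close> are then determined recursively inside \<open>K(X)\<close>, and those of \<open>G / \<gamma>\<close> and
  \<open>h(\<gamma> z)\<close> inside \<open>K(Y)\<close>; so \<open>h(\<gamma> z)\<close> has constant coefficients, \<open>F / \<gamma>\<close> and \<open>G / \<gamma>\<close> are integral
  over \<open>R\<close>, and \<open>\<gamma>\<close> divides \<open>F - G\<close>, which makes it a constant.

  Unique factorization of \<open>R\<close> is never used, only that \<open>R\<close> is completely integrally closed and that
  elements of \<open>K[X]\<close> and of \<open>K[Y]\<close> are coprime in a strong sense. Both are reduced to one variable
  \<open>T\<close> by the substitution \<open>v \<mapsto> v + T\<^sup>w\<close> with weights \<open>w\<close> chosen so that leading coefficients in \<open>T\<close>
  become constant.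
\<close>

section \<open>Polynomials in several variables\<close>

lemma polys_in_0 [simp]: "0 \<in> polys_in V"
  by (simp add: polys_in_def)

lemma polys_in_mconst [simp]: "mconst c \<in> polys_in V"
  by (simp add: polys_in_def mconst_def)

lemma polys_in_add: "p \<in> polys_in V \<Longrightarrow> q \<in> polys_in V \<Longrightarrow> p + q \<in> polys_in V"
  for p q :: "('v, 'a::comm_monoid_add) mpoly"
  using keys_add[of p q] by (auto simp: polys_in_def)

lemma polys_in_uminus: "p \<in> polys_in V \<Longrightarrow> - p \<in> polys_in V"
  for p :: "('v, 'a::ab_group_add) mpoly"
  by (auto simp: polys_in_def in_keys_iff)

lemma polys_in_diff: "p \<in> polys_in V \<Longrightarrow> q \<in> polys_in V \<Longrightarrow> p - q \<in> polys_in V"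
  for p q :: "('v, 'a::ab_group_add) mpoly"
  using polys_in_add[OF _ polys_in_uminus, of p V q] by simp

lemma polys_in_mult: "p \<in> polys_in V \<Longrightarrow> q \<in> polys_in V \<Longrightarrow> p * q \<in> polys_in V"
  for p q :: "('v, 'a::comm_semiring_0) mpoly"
  proof -
  assume p: "p \<in> polys_in V" and q: "q \<in> polys_in V"
  have "Poly_Mapping.keys m \<subseteq> V" if "m \<in> Poly_Mapping.keys (p * q)" for m
  proof -
    from that obtain a b where "m = a + b" "a \<in> Poly_Mapping.keys p" "b \<in> Poly_Mapping.keys q"
      using keys_mult[of p q] by auto
    moreover from this have "Poly_Mapping.keys a \<subseteq> V" "Poly_Mapping.keys b \<subseteq> V"
      using p q by (auto simp: polys_in_def)
    ultimately show ?thesis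
      using keys_add[of a b] by blast
  qed
  then show ?thesis by (auto simp: polys_in_def)
qed

lemma polys_in_1 [simp]: "1 \<in> polys_in V"
  for V :: "'v set"
  by (simp add: polys_in_def)

lemma polys_in_power: "p \<in> polys_in V \<Longrightarrow> p ^ n \<in> polys_in V"
  for p :: "('v, 'a::comm_semiring_1) mpoly"
  by (induction n) (auto intro: polys_in_mult)

lemma polys_in_sum: "(\<And>x. x \<in> A \<Longrightarrow> f x \<in> polys_in V) \<Longrightarrow> sum f A \<in> polys_in V"
  for f :: "_ \<Rightarrow> ('v, 'a::comm_monoid_add) mpoly"
  by (induction A rule: infinite_finite_induct) (auto intro: polys_in_add)

lemma polys_in_Int: "polys_in V \<inter> polys_in W = polys_in (V \<inter> W)"
  by (auto simp: polys_in_def)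

lemma polys_in_empty: "polys_in {} = range mconst"
proof (intro equalityI subsetI)
  fix p assume p: "p \<in> polys_in {}"
  have "p = mconst (Poly_Mapping.lookup p 0)"
  proof (rule poly_mapping_eqI)
    fix m
    show "Poly_Mapping.lookup p m = Poly_Mapping.lookup (mconst (Poly_Mapping.lookup p 0)) m"
    proof (cases "m = 0")
      case False
      then have "Poly_Mapping.keys m \<noteq> {}" by simp
      then have "m \<notin> Poly_Mapping.keys p" using p by (auto simp: polys_in_def)
      then show ?thesis using False by (simp add: mconst_def in_keys_iff lookup_single)
    qed (simp add: mconst_def)
  qed
  then show "p \<in> range mconst" by blast
qed auto

lemma mconst_0 [simp]: "mconst 0 = 0"
  by (simp add: mconst_def)

lemma mconst_1 [simp]: "mconst 1 = 1"
  by (simp add: mconst_def)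

lemma mconst_add: "mconst (a + b) = mconst a + mconst b"
  by (simp add: mconst_def single_add)

lemma mconst_mult: "mconst (a * b) = mconst a * mconst b"
  by (simp add: mconst_def mult_single)

lemma mconst_eq_iff [simp]: "mconst a = mconst b \<longleftrightarrow> a = b"
  by (metis lookup_single_eq mconst_def)

lemma mconst_dvd_1: "c \<noteq> 0 \<Longrightarrow> mconst c dvd 1"
  for c :: "'a::field"
  by (rule dvdI[of _ _ "mconst (inverse c)"]) (simp flip: mconst_mult)

section \<open>Substitution homomorphisms\<close>

definition mono_eval :: "('v \<Rightarrow> 'r::comm_semiring_1) \<Rightarrow> ('v \<Rightarrow>\<^sub>0 nat) \<Rightarrow> 'r" where
  "mono_eval \<sigma> m = (\<Prod>v\<in>Poly_Mapping.keys m. \<sigma> v ^ Poly_Mapping.lookup m v)"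

lemma mono_eval_superset:
  assumes "finite A" "Poly_Mapping.keys m \<subseteq> A"
  shows "mono_eval \<sigma> m = (\<Prod>v\<in>A. \<sigma> v ^ Poly_Mapping.lookup m v)"
  unfolding mono_eval_def using assms by (intro prod.mono_neutral_left) (auto simp: in_keys_iff)

lemma mono_eval_0 [simp]: "mono_eval \<sigma> 0 = 1"
  by (simp add: mono_eval_def)

lemma mono_eval_add: "mono_eval \<sigma> (m + n) = mono_eval \<sigma> m * mono_eval \<sigma> n"
proof -
  let ?A = "Poly_Mapping.keys m \<union> Poly_Mapping.keys n"
  show ?thesis
    using keys_add[of m n]
    by (subst (1 2 3) mono_eval_superset[of ?A]) (auto simp: lookup_add power_add prod.distrib)
qed

lemma sum_single_lookup: 
  assumes "finite A" "Poly_Mapping.keys p \<subseteq> A"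
  shows "(\<Sum>m\<in>A. Poly_Mapping.single m (Poly_Mapping.lookup p m)) = p"
proof (rule poly_mapping_eqI)
  fix k
  show "Poly_Mapping.lookup (\<Sum>m\<in>A. Poly_Mapping.single m (Poly_Mapping.lookup p m)) k = Poly_Mapping.lookup p k"
    using assms by (auto simp: lookup_sum lookup_single when_def in_keys_iff)
qed

lemma mono_eval_mvar: "mono_eval mvar m = Poly_Mapping.single m (1 :: 'a::comm_semiring_1)"
proof -
  have pow: "(mvar v :: ('b, 'a) mpoly) ^ n = Poly_Mapping.single (Poly_Mapping.single v n) 1" for v n
    by (induction n) (auto simp: mvar_def mult_single single_add[symmetric])
  have "(\<Prod>v\<in>A. Poly_Mapping.single (f v) (1::'a)) = Poly_Mapping.single (sum f A) 1"
    for A and f :: "'b \<Rightarrow> 'b \<Rightarrow>\<^sub>0 nat"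
    by (induction A rule: infinite_finite_induct) (auto simp: mult_single)
  then show ?thesis
    by (simp add: mono_eval_def pow sum_single_lookup)
qed

lemma mpoly_eval_altdef:
  "mpoly_eval \<iota> \<sigma> p = (\<Sum>m\<in>Poly_Mapping.keys p. \<iota> (Poly_Mapping.lookup p m) * mono_eval \<sigma> m)"
  by (simp add: mpoly_eval_def mono_eval_def)

text \<open>This is the universal property of polynomial rings: \<open>\<sigma>\<close> is free, and
  only \<open>\<iota>\<close> has to respect the operations. The locale lets the same laws serve
  both \<open>shift\<close> and \<open>bihomog\<close>.\<close>

locale mpoly_hom =
  fixes \<iota> :: "'a::comm_semiring_1 \<Rightarrow> 'r::comm_semiring_1" and \<sigma> :: "'v \<Rightarrow> 'r"
  assumes hom_0: "\<iota> 0 = 0" and hom_1: "\<iota> 1 = 1"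
    and hom_add: "\<iota> (a + b) = \<iota> a + \<iota> b" and hom_mult: "\<iota> (a * b) = \<iota> a * \<iota> b"
begin

lemma eval_superset:
  assumes "finite A" "Poly_Mapping.keys p \<subseteq> A"
  shows "mpoly_eval \<iota> \<sigma> p = (\<Sum>m\<in>A. \<iota> (Poly_Mapping.lookup p m) * mono_eval \<sigma> m)"
  unfolding mpoly_eval_altdef using assms
  by (intro sum.mono_neutral_left) (auto simp: in_keys_iff hom_0)

lemma eval_0 [simp]: "mpoly_eval \<iota> \<sigma> 0 = 0"
  by (simp add: mpoly_eval_def)

lemma eval_add: "mpoly_eval \<iota> \<sigma> (p + q) = mpoly_eval \<iota> \<sigma> p + mpoly_eval \<iota> \<sigma> q"
proof -
  let ?A = "Poly_Mapping.keys p \<union> Poly_Mapping.keys q"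
  show ?thesis using keys_add[of p q]
    by (subst (1 2 3) eval_superset[of ?A])
      (auto simp: lookup_add hom_add distrib_right sum.distrib)
qed

lemma eval_sum: "mpoly_eval \<iota> \<sigma> (sum f A) = (\<Sum>x\<in>A. mpoly_eval \<iota> \<sigma> (f x))"
  by (induction A rule: infinite_finite_induct) (auto simp: eval_add)

lemma eval_single: "mpoly_eval \<iota> \<sigma> (Poly_Mapping.single m c) = \<iota> c * mono_eval \<sigma> m"
  by (subst eval_superset[of "{m}"]) auto

lemma eval_1 [simp]: "mpoly_eval \<iota> \<sigma> 1 = 1"
  using eval_single[of 0 1] by (simp add: hom_1)

lemma eval_mult: "mpoly_eval \<iota> \<sigma> (p * q) = mpoly_eval \<iota> \<sigma> p * mpoly_eval \<iota> \<sigma> q"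
proof -
  let ?s = "\<lambda>p m. Poly_Mapping.single m (Poly_Mapping.lookup p m)"
  have s: "(\<Sum>m\<in>Poly_Mapping.keys p. ?s p m) = p" for p :: "('v, 'a) mpoly"
    by (rule sum_single_lookup) auto
  have "mpoly_eval \<iota> \<sigma> ((\<Sum>m\<in>Poly_Mapping.keys p. ?s p m) * (\<Sum>m\<in>Poly_Mapping.keys q. ?s q m))
      = mpoly_eval \<iota> \<sigma> (\<Sum>m\<in>Poly_Mapping.keys p. ?s p m) * mpoly_eval \<iota> \<sigma> (\<Sum>m\<in>Poly_Mapping.keys q. ?s q m)"
    by (simp add: sum_product eval_sum eval_single mult_single mono_eval_add hom_mult mult_ac)
  then show ?thesis by (simp only: s)
qed

lemma eval_power: "mpoly_eval \<iota> \<sigma> (p ^ n) = mpoly_eval \<iota> \<sigma> p ^ n"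
  by (induction n) (auto simp: eval_mult)

end

text \<open>Serves to compare substitutions: once \<open>f\<close> is pushed inside, only its effect
  on constants and variables remains to be checked.\<close>

lemma mpoly_eval_hom_comp:
  fixes p :: "('v, 'a::zero) mpoly" and f :: "'r::comm_semiring_1 \<Rightarrow> 's::comm_semiring_1"
  assumes "\<And>x y. f (x + y) = f x + f y" "\<And>x y. f (x * y) = f x * f y" "f 0 = 0" "f 1 = 1"
  shows "f (mpoly_eval \<iota> \<sigma> p) = mpoly_eval (f \<circ> \<iota>) (f \<circ> \<sigma>) p"
proof -
  have s: "f (sum g A) = (\<Sum>x\<in>A. f (g x))" for g and A :: "('v \<Rightarrow>\<^sub>0 nat) set"
    by (induction A rule: infinite_finite_induct) (auto simp: assms)
  have p: "f (prod g A) = (\<Prod>x\<in>A. f (g x))" for g and A :: "'v set"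
    by (induction A rule: infinite_finite_induct) (auto simp: assms)
  have q: "f (x ^ n) = f x ^ n" for x n
    by (induction n) (auto simp: assms)
  show ?thesis by (simp add: mpoly_eval_def s p q assms)
qed

lemma mpoly_eval_mconst_mvar: "mpoly_eval mconst mvar p = (p :: ('v, 'a::comm_semiring_1) mpoly)"
  by (simp add: mpoly_eval_altdef mono_eval_mvar mconst_def mult_single sum_single_lookup)

section \<open>Weighted substitutions and their leading coefficients\<close>

text \<open>Each new variable \<open>x\<close> gets a weight \<open>N\<close> above every weighted
  degree that occurs in \<open>M\<close> so far. The new weighted degree is then a number in base
  \<open>N\<close>: its remainder is the old weighted degree, its quotient the exponent of
  \<open>x\<close>.\<close>

lemma exists_separating_weight:
  fixes M :: "('v \<Rightarrow>\<^sub>0 nat) set"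
  assumes "finite V" "finite M"
  shows "\<exists>w. (\<forall>v. w v > 0) \<and> (\<forall>m\<in>M. \<forall>n\<in>M.
     (\<Sum>v\<in>V. w v * Poly_Mapping.lookup m v) = (\<Sum>v\<in>V. w v * Poly_Mapping.lookup n v) \<longrightarrow>
     (\<forall>v\<in>V. Poly_Mapping.lookup m v = Poly_Mapping.lookup n v))"
  using assms(1)
proof induction
  case empty
  show ?case by (auto intro: exI[of _ "\<lambda>_. 1"])
next
  case (insert x V)
  then obtain w where w: "\<forall>v. w v > (0::nat)" "\<forall>m\<in>M. \<forall>n\<in>M.
     (\<Sum>v\<in>V. w v * Poly_Mapping.lookup m v) = (\<Sum>v\<in>V. w v * Poly_Mapping.lookup n v) \<longrightarrow>
     (\<forall>v\<in>V. Poly_Mapping.lookup m v = Poly_Mapping.lookup n v)"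
    by blast
  define s where "s m = (\<Sum>v\<in>V. w v * Poly_Mapping.lookup m v)" for m
  define N where "N = Suc (\<Sum>m\<in>M. s m)"
  have sN: "s m < N" if "m \<in> M" for m
    unfolding N_def using member_le_sum[of m M s] assms(2) that by (simp add: less_Suc_eq_le)
  define w' where "w' = w(x := N)"
  have s': "(\<Sum>v\<in>insert x V. w' v * Poly_Mapping.lookup m v) = s m + N * Poly_Mapping.lookup m x" for m
  proof -
    have "(\<Sum>v\<in>V. w' v * Poly_Mapping.lookup m v) = s m"
      unfolding s_def using insert.hyps by (intro sum.cong) (auto simp: w'_def)
    then show ?thesis using insert.hyps by (simp add: w'_def)
  qed
  have "\<forall>v\<in>insert x V. Poly_Mapping.lookup m v = Poly_Mapping.lookup n v"
    if "m \<in> M" "n \<in> M" "s m + N * Poly_Mapping.lookup m x = s n + N * Poly_Mapping.lookup n x" for m n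
  proof -
    have "s m = s n"
      using arg_cong[OF that(3), of "\<lambda>k. k mod N"] sN[OF that(1)] sN[OF that(2)] by simp
    moreover have "Poly_Mapping.lookup m x = Poly_Mapping.lookup n x"
    proof -
      have "N * Poly_Mapping.lookup m x = N * Poly_Mapping.lookup n x"
        using that(3) \<open>s m = s n\<close> by linarith
      then show ?thesis by (simp add: N_def del: mult_Suc)
    qed
    moreover have "\<forall>v\<in>V. Poly_Mapping.lookup m v = Poly_Mapping.lookup n v"
      using w(2) that(1,2) \<open>s m = s n\<close> unfolding s_def by blast
    ultimately show ?thesis by blast
  qed
  then show ?case
    unfolding s'[symmetric] using w(1) by (intro exI[of _ w'] conjI ballI impI allI) (simp add: w'_def N_def, blast)
qed

text \<open>The outer polynomial variable is the \<open>T\<close> of the overview. Variables outside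
  \<open>V\<close> stay fixed, so polynomials in them become constants with respect to
  \<open>T\<close>.\<close>

definition shift :: "'v set \<Rightarrow> ('v \<Rightarrow> nat) \<Rightarrow> ('v, 'a::comm_semiring_1) mpoly \<Rightarrow> ('v, 'a) mpoly poly" where
  "shift V w = mpoly_eval (\<lambda>c. [:mconst c:]) (\<lambda>v. [:mvar v:] + (if v \<in> V then monom 1 (w v) else 0))"

global_interpretation shift: mpoly_hom "\<lambda>c. [:mconst c:]"
    "\<lambda>v. [:mvar v:] + (if v \<in> V then monom 1 (w v) else 0)"
  rewrites "mpoly_eval (\<lambda>c. [:mconst c:]) (\<lambda>v. [:mvar v:] + (if v \<in> V then monom 1 (w v) else 0)) = shift V w"
  for V :: "'v set" and w
  by unfold_locales (auto simp: mconst_add mconst_mult one_pCons shift_def mult.commute)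

text \<open>At \<open>T = 0\<close> the added powers vanish because the weights are positive. Hence
  \<open>shift\<close> is injective, and a factorization of a shifted polynomial specializes to one
  of the original polynomial.\<close>

lemma poly_shift_0:
  assumes "\<And>v. w v > 0"
  shows "poly (shift V w p) 0 = p"
proof -
  have "poly (shift V w p) 0 = mpoly_eval ((\<lambda>q. poly q 0) \<circ> (\<lambda>c. [:mconst c:]))
      ((\<lambda>q. poly q 0) \<circ> (\<lambda>v. [:mvar v:] + (if v \<in> V then monom 1 (w v) else 0))) p"
    unfolding shift_def by (rule mpoly_eval_hom_comp) auto
  also have "\<dots> = mpoly_eval mconst mvar p"
    using assms by (intro arg_cong2[of _ _ _ _ "\<lambda>a b. mpoly_eval a b p"])
      (auto simp: fun_eq_iff poly_monom zero_power)
  finally show ?thesis by (simp add: mpoly_eval_mconst_mvar)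
qed

lemma shift_disjoint:
  assumes "p \<in> polys_in W" "W \<inter> V = {}"
  shows "shift V w p = [:p:]"
proof -
  have "mono_eval (\<lambda>v. [:mvar v:] + (if v \<in> V then monom 1 (w v) else 0)) m
      = [:mono_eval mvar m :: ('a, 'b) mpoly:]" if "m \<in> Poly_Mapping.keys p" for m
  proof -
    have "(\<Prod>v\<in>A. ([:mvar v:] + (if v \<in> V then monom 1 (w v) else 0)) ^ Poly_Mapping.lookup m v)
        = [:\<Prod>v\<in>A. mvar v ^ Poly_Mapping.lookup m v :: ('a, 'b) mpoly:]" if "A \<inter> V = {}" for A
      using that
      by (induction A rule: infinite_finite_induct) (auto simp: one_pCons poly_const_pow mult.commute)
    moreover have "Poly_Mapping.keys m \<inter> V = {}"
      using assms that by (auto simp: polys_in_def)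
    ultimately show ?thesis by (simp add: mono_eval_def)
  qed
  then have "shift V w p = [:mpoly_eval mconst mvar p:]"
    unfolding shift_def mpoly_eval_altdef by (simp add: mult.commute sum_to_poly)
  then show ?thesis by (simp add: mpoly_eval_mconst_mvar)
qed

definition restrict_mono :: "'v set \<Rightarrow> ('v \<Rightarrow>\<^sub>0 nat) \<Rightarrow> 'v \<Rightarrow>\<^sub>0 nat" where
  "restrict_mono V m = (\<Sum>v\<in>Poly_Mapping.keys m \<inter> V. Poly_Mapping.single v (Poly_Mapping.lookup m v))"

lemma lookup_restrict_mono:
  "Poly_Mapping.lookup (restrict_mono V m) v = (if v \<in> V then Poly_Mapping.lookup m v else 0)"
  by (auto simp: restrict_mono_def lookup_sum lookup_single when_def in_keys_iff)

text \<open>A monomial \<open>m\<close> turns into its part outside \<open>V\<close> times a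
  polynomial that is monic in \<open>T\<close> and has as degree the weight of \<open>m\<close>. The
  top coefficient thus collects the outside parts of the monomials of maximal weight. By separation
  these agree on \<open>V\<close>, so their outside parts are distinct and nothing cancels.\<close>

lemma lead_coeff_shift:
  fixes u :: "('v::{finite,linorder}, 'a::idom) mpoly"
  assumes w: "\<And>v. w v > 0"
    and sep: "\<And>m n. m \<in> M \<Longrightarrow> n \<in> M \<Longrightarrow>
      (\<Sum>v\<in>V. w v * Poly_Mapping.lookup m v) = (\<Sum>v\<in>V. w v * Poly_Mapping.lookup n v) \<Longrightarrow>
      (\<forall>v\<in>V. Poly_Mapping.lookup m v = Poly_Mapping.lookup n v)"
    and u: "Poly_Mapping.keys u \<subseteq> M" "u \<in> polys_in W"
  shows "lead_coeff (shift V w u) \<in> polys_in (W - V)"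
proof (cases "u = 0")
  case False
  define wt where "wt m = (\<Sum>v\<in>V. w v * Poly_Mapping.lookup m v)" for m
  define \<sigma> :: "'v \<Rightarrow> ('v, 'a) mpoly poly" where
    "\<sigma> = (\<lambda>v. [:mvar v:] + (if v \<in> V then monom 1 (w v) else 0))"
  define B where "B m = (\<Prod>v\<in>V. \<sigma> v ^ Poly_Mapping.lookup m v)" for m
  have deg\<sigma>: "degree (\<sigma> v) = w v" and lc\<sigma>: "lead_coeff (\<sigma> v) = 1" if "v \<in> V" for v
  proof -
    have *: "\<sigma> v = monom 1 (w v) + [:mvar v:]" using that by (simp add: \<sigma>_def add.commute)
    have **: "degree [:mvar v :: ('v, 'a) mpoly:] < degree (monom 1 (w v) :: ('v, 'a) mpoly poly)"
      using w by (simp add: degree_monom_eq)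
    show "degree (\<sigma> v) = w v" "lead_coeff (\<sigma> v) = 1"
      unfolding * by (simp_all only: degree_add_eq_left[OF **] lead_coeff_add_le[OF **]
        degree_monom_eq[OF one_neq_zero] coeff_monom coeff_add) (use w[of v] in \<open>auto simp: coeff_pCons split: nat.splits\<close>)
  qed
  have \<sigma>0: "\<sigma> v \<noteq> 0" if "v \<in> V" for v
    using lc\<sigma>[OF that] by auto
  have degB: "degree (B m) = wt m" for m
    unfolding B_def wt_def using \<sigma>0
    by (subst degree_prod_sum_eq) (auto simp: degree_power_eq deg\<sigma> mult.commute intro!: sum.cong)
  have lcB: "lead_coeff (B m) = 1" for m
    unfolding B_def by (simp add: lead_coeff_prod lead_coeff_power lc\<sigma>)
  \<comment> \<open>The variables in \<open>V\<close> contribute the monic polynomial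
    \<open>B m\<close>, the remaining ones a monomial free of \<open>T\<close>.\<close>
  have C: "mono_eval \<sigma> m = smult (Poly_Mapping.single (restrict_mono (-V) m) 1) (B m)" for m
  proof -
    have "mono_eval \<sigma> m = (\<Prod>v\<in>V \<union> -V. \<sigma> v ^ Poly_Mapping.lookup m v)"
      by (rule mono_eval_superset) auto
    also have "\<dots> = B m * (\<Prod>v\<in>-V. \<sigma> v ^ Poly_Mapping.lookup m v)"
      unfolding B_def by (rule prod.union_disjoint) auto
    also have "(\<Prod>v\<in>-V. \<sigma> v ^ Poly_Mapping.lookup m v) = (\<Prod>v\<in>-V. [:mvar v ^ Poly_Mapping.lookup m v:])"
      by (intro prod.cong) (auto simp: \<sigma>_def poly_const_pow)
    also have "\<dots> = [:\<Prod>v\<in>-V. mvar v ^ Poly_Mapping.lookup m v:]"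
      by (induction "-V" rule: infinite_finite_induct) (auto simp: prod_to_poly[symmetric])
    also have "(\<Prod>v\<in>-V. mvar v ^ Poly_Mapping.lookup m v) = mono_eval mvar (restrict_mono (-V) m)"
      by (subst mono_eval_superset[of "-V"])
        (auto simp: lookup_restrict_mono in_keys_iff split: if_splits intro!: prod.cong)
    also have "\<dots> = (Poly_Mapping.single (restrict_mono (-V) m) 1)"
      by (rule mono_eval_mvar)
    finally show ?thesis by (simp add: mult.commute)
  qed
  define \<mu> where "\<mu> = Max (wt ` Poly_Mapping.keys u)"
  have wt_le: "wt m \<le> \<mu>" if "m \<in> Poly_Mapping.keys u" for m
    unfolding \<mu>_def using that by (intro Max_ge) auto
  have "\<mu> \<in> wt ` Poly_Mapping.keys u"
    unfolding \<mu>_def using False by (intro Max_in) auto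
  then obtain m0 where m0: "m0 \<in> Poly_Mapping.keys u" "wt m0 = \<mu>" by auto
  define top where "top = (\<Sum>m | m \<in> Poly_Mapping.keys u \<and> wt m = \<mu>.
    Poly_Mapping.single (restrict_mono (-V) m) (Poly_Mapping.lookup u m))"
  have shift_eq: "shift V w u = (\<Sum>m\<in>Poly_Mapping.keys u.
      smult (Poly_Mapping.single (restrict_mono (-V) m) (Poly_Mapping.lookup u m)) (B m))"
    unfolding shift_def mpoly_eval_altdef \<sigma>_def[symmetric] C
    by (simp add: mconst_def mult_single)
  have "degree (shift V w u) \<le> \<mu>"
    unfolding shift_eq using wt_le degB by (intro degree_sum_le order.trans[OF degree_smult_le]) auto
  have "coeff (shift V w u) \<mu> = (\<Sum>m\<in>Poly_Mapping.keys u.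
      Poly_Mapping.single (restrict_mono (-V) m) (Poly_Mapping.lookup u m) * coeff (B m) \<mu>)"
    unfolding shift_eq by (simp add: coeff_sum)
  also have "\<dots> = (\<Sum>m\<in>Poly_Mapping.keys u. if wt m = \<mu> then 
      Poly_Mapping.single (restrict_mono (-V) m) (Poly_Mapping.lookup u m) else 0)"
  proof (intro sum.cong refl)
    fix m assume "m \<in> Poly_Mapping.keys u"
    then show "Poly_Mapping.single (restrict_mono (-V) m) (Poly_Mapping.lookup u m) * coeff (B m) \<mu>
      = (if wt m = \<mu> then Poly_Mapping.single (restrict_mono (-V) m) (Poly_Mapping.lookup u m) else 0)"
      using lcB[of m] degB[of m] wt_le[of m] by (cases "wt m = \<mu>") (auto simp: coeff_eq_0)
  qed
  also have "\<dots> = top"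
    unfolding top_def by (rule sum.inter_filter[symmetric]) simp
  finally have coeff\<mu>: "coeff (shift V w u) \<mu> = top" .
  \<comment> \<open>The part of \<open>m0\<close> outside \<open>V\<close> occurs in
    \<open>top\<close> through \<open>m0\<close> alone, so its coefficient there is that of
    \<open>m0\<close> in \<open>u\<close>, which is nonzero.\<close>
  have "Poly_Mapping.lookup top (restrict_mono (-V) m0) = (\<Sum>m | m \<in> Poly_Mapping.keys u \<and> wt m = \<mu>.
     if m = m0 then Poly_Mapping.lookup u m else 0)"
    unfolding top_def lookup_sum
  proof (intro sum.cong refl)
    fix m assume "m \<in> {m \<in> Poly_Mapping.keys u. wt m = \<mu>}"
    then have V: "\<forall>v\<in>V. Poly_Mapping.lookup m v = Poly_Mapping.lookup m0 v"
      using sep[of m m0] u(1) m0 by (auto simp: wt_def)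
    have "m = m0" if "restrict_mono (-V) m = restrict_mono (-V) m0"
    proof (rule poly_mapping_eqI)
      fix v
      show "Poly_Mapping.lookup m v = Poly_Mapping.lookup m0 v"
        using V arg_cong[OF that, of "\<lambda>m. Poly_Mapping.lookup m v"]
        by (cases "v \<in> V") (auto simp: lookup_restrict_mono)
    qed
    then show "Poly_Mapping.lookup (Poly_Mapping.single (restrict_mono (-V) m) (Poly_Mapping.lookup u m)) (restrict_mono (-V) m0)
      = (if m = m0 then Poly_Mapping.lookup u m else 0)"
      by (auto simp: lookup_single when_def)
  qed
  also have "\<dots> = Poly_Mapping.lookup u m0"
    using m0 by (subst sum.delta) auto
  finally have "top \<noteq> 0"
    using m0 by (auto simp: in_keys_iff)
  then have "lead_coeff (shift V w u) = top"
    using coeff\<mu> \<open>degree (shift V w u) \<le> \<mu>\<close> le_degree[of "shift V w u" \<mu>] by auto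
  moreover have "top \<in> polys_in (W - V)"
    unfolding top_def
  proof (intro polys_in_sum)
    fix m assume "m \<in> {m \<in> Poly_Mapping.keys u. wt m = \<mu>}"
    then have "Poly_Mapping.keys m \<subseteq> W" using u(2) by (simp add: polys_in_def)
    then have "Poly_Mapping.keys (restrict_mono (-V) m) \<subseteq> W - V"
      by (auto simp: in_keys_iff lookup_restrict_mono split: if_splits)
    then show "Poly_Mapping.single (restrict_mono (-V) m) (Poly_Mapping.lookup u m) \<in> polys_in (W - V)"
      by (auto simp: polys_in_def)
  qed
  ultimately show ?thesis by simp
qed simp

section \<open>Divisibility in polynomial rings\<close>

text \<open>One weight is good for all polynomials supported in \<open>M\<close>, so that the
  leading coefficients of several polynomials can be controlled by the same substitution.\<close>

lemma exists_shift:
  assumes "finite M"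
  obtains w :: "'v::{finite,linorder} \<Rightarrow> nat" where "\<And>v. w v > 0"
    "\<And>(u :: ('v, 'a::idom) mpoly) W. Poly_Mapping.keys u \<subseteq> M \<Longrightarrow> u \<in> polys_in W \<Longrightarrow>
       lead_coeff (shift V w u) \<in> polys_in (W - V)"
proof -
  obtain w where w: "\<forall>v. w v > (0::nat)" "\<forall>m\<in>M. \<forall>n\<in>M.
     (\<Sum>v\<in>V. w v * Poly_Mapping.lookup m v) = (\<Sum>v\<in>V. w v * Poly_Mapping.lookup n v) \<longrightarrow>
     (\<forall>v\<in>V. Poly_Mapping.lookup m v = Poly_Mapping.lookup n v)"
    using exists_separating_weight[OF _ assms, of V] by auto
  have "lead_coeff (shift V w u) \<in> polys_in (W - V)"
    if "Poly_Mapping.keys u \<subseteq> M" "u \<in> polys_in W" for u :: "('v, 'a) mpoly" and W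
    using w that by (intro lead_coeff_shift[of w M]) blast+
  with w(1) show ?thesis using that by blast
qed

lemma exists_shift1:
  fixes u :: "('v::{finite,linorder}, 'a::idom) mpoly"
  assumes "u \<in> polys_in W"
  obtains w where "\<And>v. w v > 0" "lead_coeff (shift V w u) \<in> polys_in (W - V)"
proof (rule exists_shift[OF finite_keys[of u], of V])
  fix w :: "'v \<Rightarrow> nat"
  assume w: "\<And>v. w v > 0" "\<And>(u' :: ('v, 'a) mpoly) W. Poly_Mapping.keys u' \<subseteq> Poly_Mapping.keys u \<Longrightarrow>
     u' \<in> polys_in W \<Longrightarrow> lead_coeff (shift V w u') \<in> polys_in (W - V)"
  show ?thesis using that[OF w(1) w(2)[OF order_refl assms]] .
qed

lemma shift_eq_0_iff:
  assumes "\<And>v. w v > 0"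
  shows "shift V w u = 0 \<longleftrightarrow> u = 0"
  using poly_shift_0[of w V u] assms by auto

text \<open>Shifting the variables outside \<open>V\<close> leaves \<open>p\<close> constant in
  \<open>T\<close>. By degrees the shifted divisor is constant in \<open>T\<close> too, hence equal
  to its leading coefficient, which lies in \<open>polys_in V\<close>; setting \<open>T = 0\<close>
  gives back \<open>u\<close>.\<close>

lemma polys_in_dvd:
  fixes u :: "('v::{finite,linorder}, 'a::idom) mpoly"
  assumes "u dvd p" "p \<in> polys_in V" "p \<noteq> 0"
  shows "u \<in> polys_in V"
proof -
  obtain q where q: "p = u * q" using assms(1) by (elim dvdE)
  obtain w where w: "\<And>v. w v > 0" "lead_coeff (shift (-V) w u) \<in> polys_in (UNIV - -V)"
    by (rule exists_shift1[of u UNIV "-V"]) (auto simp: polys_in_def)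
  have "shift (-V) w u * shift (-V) w q = [:p:]"
    using assms(2) q by (simp flip: shift.eval_mult add: shift_disjoint)
  moreover have "shift (-V) w u \<noteq> 0" "shift (-V) w q \<noteq> 0"
    using assms(3) q w(1) by (auto simp: shift_eq_0_iff)
  ultimately have "degree (shift (-V) w u) = 0"
    using degree_mult_eq[of "shift (-V) w u" "shift (-V) w q"] by simp
  then have "shift (-V) w u = [:lead_coeff (shift (-V) w u):]"
    by (metis degree_eq_zeroE lead_coeff_pCons(2))
  then have "u = lead_coeff (shift (-V) w u)"
    using poly_shift_0[of w "-V" u, OF w(1)] by (metis poly_const_conv)
  then show ?thesis using w(2) by (simp add: double_compl Compl_eq_Diff_UNIV[symmetric])
qed

lemma dvd_1_iff:
  fixes u :: "('v::{finite,linorder}, 'a::field) mpoly"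
  shows "u dvd 1 \<longleftrightarrow> u \<in> range mconst \<and> u \<noteq> 0"
proof
  assume "u dvd 1"
  then show "u \<in> range mconst \<and> u \<noteq> 0"
    using polys_in_dvd[of u 1 "{}"] unfolding polys_in_empty[symmetric] by auto
next
  assume "u \<in> range mconst \<and> u \<noteq> 0"
  then obtain c where "u = mconst c" "c \<noteq> 0" by (metis imageE mconst_0)
  then show "u dvd 1" by (simp add: mconst_dvd_1)
qed

lemma dvd_cancel_unit:
  fixes a b c :: "'r::comm_semiring_1"
  assumes "b dvd 1" "a dvd b * c"
  shows "a dvd c"
proof -
  obtain e where "1 = b * e" using assms(1) by (elim dvdE)
  then have "c = e * (b * c)" by (metis mult.assoc mult.commute mult.left_neutral)
  then show ?thesis using assms(2) by (metis dvd_mult)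
qed

text \<open>The leading coefficient of \<open>B * U\<close> shows that \<open>a\<close> divides that
  of \<open>U\<close>. Removing the leading term of \<open>U\<close> keeps the hypothesis and lowers
  the degree.\<close>

lemma const_dvd_cancel_unit_lead:
  fixes B U :: "'r::idom poly"
  assumes "lead_coeff B dvd 1" "[:a:] dvd B * U"
  shows "[:a:] dvd U"
  using assms(2)
proof (induction "degree U" arbitrary: U rule: less_induct)
  case less
  show ?case
  proof (cases "U = 0")
    case False
    have "a dvd lead_coeff B * lead_coeff U"
      using less.prems unfolding const_poly_dvd_iff lead_coeff_mult[symmetric] by blast
    then have a: "a dvd lead_coeff U"
      by (rule dvd_cancel_unit[OF assms(1)])
    define M where "M = monom (lead_coeff U) (degree U)"
    have M: "[:a:] dvd M" using a by (auto simp: const_poly_dvd_iff M_def)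
    have "[:a:] dvd U - M"
    proof (cases "degree U = 0")
      case True
      then have "U - M = 0" by (auto simp: M_def monom_0 elim: degree_eq_zeroE)
      then show ?thesis by simp
    next
      case False
      have "degree (U - M) < degree U"
      proof (rule degree_lessI)
        show "\<forall>k\<ge>degree U. coeff (U - M) k = 0"
          by (auto simp: M_def coeff_eq_0)
      qed (use False in auto)
      moreover have "[:a:] dvd B * (U - M)"
        using less.prems M by (simp add: right_diff_distrib)
      ultimately show ?thesis by (rule less.hyps)
    qed
    then show ?thesis using M by (metis diff_add_cancel dvd_add)
  qed simp
qed

text \<open>This is the strong coprimality of polynomials in disjoint variables. Shifting the
  variables in \<open>W\<close> keeps \<open>a\<close> constant and makes the leading coefficient of
  \<open>b\<close> a nonzero element of the field, so \<open>b\<close> can be cancelled before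
  returning to \<open>T = 0\<close>.\<close>

lemma dvd_cancel_disjoint:
  fixes a b :: "('v::{finite,linorder}, 'a::field) mpoly"
  assumes "a \<in> polys_in V" "b \<in> polys_in W" "V \<inter> W = {}" "b \<noteq> 0" "a dvd b * u"
  shows "a dvd u"
proof -
  obtain w where w: "\<And>v. w v > 0" "lead_coeff (shift W w b) \<in> polys_in (W - W)"
    by (rule exists_shift1[OF assms(2), of W]) blast
  have "lead_coeff (shift W w b) \<noteq> 0"
    using w(1) assms(4) by (simp add: shift_eq_0_iff)
  then have "lead_coeff (shift W w b) dvd 1"
    using w(2) dvd_1_iff[of "lead_coeff (shift W w b)"] by (simp add: polys_in_empty)
  moreover have "shift W w a = [:a:]"
    using assms by (intro shift_disjoint)
  then have "[:a:] dvd shift W w b * shift W w u"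
    using assms(5) by (metis dvd_def shift.eval_mult)
  ultimately have "[:a:] dvd shift W w u"
    by (rule const_dvd_cancel_unit_lead)
  then obtain q where "shift W w u = [:a:] * q" by (elim dvdE)
  then have "u = a * poly q 0"
    using poly_shift_0[of w W u, OF w(1)] by (metis poly_mult poly_const_conv)
  then show ?thesis by simp
qed

section \<open>Complete integral closedness\<close>

lemma field_poly_unit_iff: "p dvd 1 \<longleftrightarrow> degree p = 0 \<and> p \<noteq> 0"
  for p :: "'k::field poly"
  by (cases "p = 0") (auto simp: is_unit_iff_degree)

text \<open>A divisor of least positive degree is irreducible, since its factors divide
  \<open>g\<close> as well, and irreducible polynomials over a field are prime.\<close>

lemma field_poly_prime_divisor:
  fixes g :: "'k::field poly"
  assumes "degree g > 0"
  obtains q where "q dvd g" "prime_elem q" "degree q > 0"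
proof -
  define q where "q = arg_min degree (\<lambda>q. q dvd g \<and> degree q > 0)"
  have "(q dvd g \<and> degree q > 0) \<and> (\<forall>r. r dvd g \<and> degree r > 0 \<longrightarrow> degree q \<le> degree r)"
    unfolding q_def by (rule arg_min_nat_lemma[of _ g]) (use assms in simp)
  then have q: "q dvd g" "degree q > 0" and min: "\<And>r. r dvd g \<Longrightarrow> degree r > 0 \<Longrightarrow> degree q \<le> degree r"
    by auto
  have "irreducible q"
  proof (rule irreducibleI)
    fix a b assume ab: "q = a * b"
    then have nz: "a \<noteq> 0" "b \<noteq> 0" using q(2) by auto
    have "a dvd g" using q(1) by (auto simp: ab dest: dvd_mult_left)
    then have "degree a = 0 \<or> degree q \<le> degree a" using min[of a] by blast
    then have "degree a = 0 \<or> degree b = 0"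
      using nz by (auto simp: ab degree_mult_eq)
    then show "a dvd 1 \<or> b dvd 1" using nz by (auto simp: field_poly_unit_iff)
  qed (use q(2) field_poly_unit_iff[of q] in auto)
  then show ?thesis using that[of q] q field_poly_irreducible_imp_prime by blast
qed

text \<open>Here \<open>c\<close> is a common denominator of all powers of \<open>A / g\<close>. A
  prime factor \<open>q\<close> of \<open>g\<close> must divide \<open>A\<close>, as otherwise every
  power of \<open>q\<close> would divide \<open>c\<close>. Cancelling \<open>q\<close> from both
  \<open>g\<close> and \<open>A\<close> preserves the hypothesis and lowers the degree of
  \<open>g\<close>.\<close>

lemma field_poly_dvd_of_powers:
  fixes g A c :: "'k::field poly"
  assumes "\<And>n. g ^ n dvd c * A ^ n" "c \<noteq> 0" "g \<noteq> 0"
  shows "g dvd A"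
  using assms(1,3)
proof (induction "degree g" arbitrary: g A rule: less_induct)
  case less
  show ?case
  proof (cases "g dvd 1")
    case False
    then have "degree g > 0" using less.prems(2) by (simp add: field_poly_unit_iff)
    then obtain q where q: "q dvd g" "prime_elem q" and degq: "degree q > 0"
      by (rule field_poly_prime_divisor)
    have "q dvd A"
    proof (rule ccontr)
      assume "\<not> q dvd A"
      have "q ^ n dvd c" for n
      proof -
        have "q ^ n dvd c * A ^ n"
          using less.prems(1)[of n] dvd_power_same[OF q(1), of n] dvd_trans by blast
        then show ?thesis
          using \<open>\<not> q dvd A\<close> q(2) prime_power_dvd_multD[of q n "A ^ n" c] prime_elem_dvd_power[of q A n]
          by (cases "n = 0") (auto simp: mult.commute)
      qed
      \<comment> \<open>The exponent is chosen so that \<open>q ^ n\<close> has larger degree than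
        \<open>c\<close>.\<close>
      from dvd_imp_degree_le[OF this[of "Suc (degree c)"]] assms(2)
      have "Suc (degree c) * degree q \<le> degree c"
        using degq by (subst (asm) degree_power_eq) auto
      with degq show False by (cases "degree q") auto
    qed
    then obtain A' where A': "A = q * A'" by (elim dvdE)
    obtain g' where g': "g = q * g'" using q(1) by (elim dvdE)
    have q0: "q \<noteq> 0" "g' \<noteq> 0" using less.prems(2) g' by auto
    have "g' dvd A'"
    proof (rule less.hyps)
      show "degree g' < degree g" using g' q0 degq by (simp add: degree_mult_eq)
      fix n
      have "q ^ n * g' ^ n dvd q ^ n * (c * A' ^ n)"
        using less.prems(1)[of n] by (simp add: A' g' power_mult_distrib mult_ac)
      then show "g' ^ n dvd c * A' ^ n" using q0 by simp
    qed (use q0 in simp)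
    then show ?thesis by (simp add: A' g')
  qed (use dvd_trans one_dvd in blast)
qed

lemma fract_poly_mult: "map_poly to_fract (p * q) = map_poly to_fract p * map_poly to_fract q"
  by (rule poly_eqI) (simp add: coeff_mult coeff_map_poly)

lemma fract_poly_power: "map_poly to_fract (p ^ n) = map_poly to_fract p ^ n"
  by (induction n) (auto simp: fract_poly_mult)

lemma fract_poly_eq_iff: "map_poly to_fract p = map_poly to_fract q \<longleftrightarrow> p = q"
  by (simp add: poly_eq_iff coeff_map_poly)

text \<open>The pseudo-remainder is a multiple of \<open>g\<close> over the fraction field and of
  smaller degree if nonzero, so it vanishes. The factor introduced by pseudo-division is a power of
  the unit leading coefficient.\<close>

lemma fract_poly_dvd_unit_lead:
  fixes g A :: "'r::idom poly"
  assumes "map_poly to_fract g dvd map_poly to_fract A" "lead_coeff g dvd 1"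
  shows "g dvd A"
proof -
  have g0: "g \<noteq> 0" using assms(2) by auto
  obtain q r where qr: "pseudo_divmod A g = (q, r)" by fastforce
  from pseudo_divmod[OF g0 qr]
  have *: "smult (lead_coeff g ^ (Suc (degree A) - degree g)) A = g * q + r" 
    and r: "r = 0 \<or> degree r < degree g" by blast+
  let ?f = "map_poly to_fract"
  have "?f g dvd ?f r"
  proof -
    have "?f (smult (lead_coeff g ^ (Suc (degree A) - degree g)) A) = ?f g * ?f q + ?f r"
      unfolding * by (simp add: fract_poly_mult)
    then have "?f r = smult (to_fract (lead_coeff g ^ (Suc (degree A) - degree g))) (?f A) - ?f g * ?f q"
      by simp
    then show ?thesis using assms(1) by (metis dvd_diff dvd_smult dvd_triv_left)
  qed
  then have "r = 0"
    using r dvd_imp_degree_le[of "?f g" "?f r"]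
    by (cases "r = 0") (auto simp: degree_map_poly map_poly_eq_0_iff)
  then have dvd: "g dvd smult (lead_coeff g ^ (Suc (degree A) - degree g)) A" using * by simp
  have "lead_coeff g ^ n dvd 1" for n
    using dvd_power_same[OF assms(2), of n] by simp
  then have "[:lead_coeff g ^ (Suc (degree A) - degree g):] dvd 1"
    by (simp add: one_pCons)
  then show ?thesis by (rule dvd_cancel_unit) (use dvd in simp)
qed

text \<open>Shifting all variables makes the leading coefficient of \<open>g\<close> a unit. The
  one-variable result applies over the fraction field, the unit brings the divisibility back to the
  polynomial ring, and \<open>T = 0\<close> undoes the shift.\<close>

lemma mpoly_dvd_of_powers:
  fixes g A c :: "('v::{finite,linorder}, 'a::field) mpoly"
  assumes "\<And>n. g ^ n dvd c * A ^ n" "c \<noteq> 0"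
  shows "g dvd A"
proof (cases "g = 0")
  case True
  then show ?thesis using assms(1)[of 1] assms(2) by simp
next
  case False
  let ?f = "map_poly to_fract"
  obtain w where w: "\<And>v. w v > 0" "lead_coeff (shift UNIV w g) \<in> polys_in (UNIV - UNIV)"
    by (rule exists_shift1[of g UNIV UNIV]) (auto simp: polys_in_def)
  let ?s = "shift UNIV w"
  have nz: "?s g \<noteq> 0" "?s c \<noteq> 0"
    using w(1) False assms(2) by (auto simp: shift_eq_0_iff)
  then have unit: "lead_coeff (?s g) dvd 1"
    using w(2) dvd_1_iff[of "lead_coeff (?s g)"] by (simp add: polys_in_empty)
  have "?f (?s g) ^ n dvd ?f (?s c) * ?f (?s A) ^ n" for n
  proof -
    obtain q where "c * A ^ n = g ^ n * q" using assms(1)[of n] by (elim dvdE)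
    then have "?f (?s (c * A ^ n)) = ?f (?s (g ^ n * q))" by simp
    then show ?thesis
      by (simp only: shift.eval_mult shift.eval_power fract_poly_mult fract_poly_power dvd_triv_left)
  qed
  then have "?f (?s g) dvd ?f (?s A)"
  proof (rule field_poly_dvd_of_powers)
    show "?f (?s c) \<noteq> 0" "?f (?s g) \<noteq> 0"
      using nz fract_poly_eq_iff[of _ 0] by simp_all
  qed
  then have "?s g dvd ?s A" using unit by (rule fract_poly_dvd_unit_lead)
  then obtain q where "?s A = ?s g * q" by (elim dvdE)
  then have "A = g * poly q 0"
    using poly_shift_0[of w UNIV A, OF w(1)] poly_shift_0[of w UNIV g, OF w(1)] by simp
  then show ?thesis by simp
qed

text \<open>The hypothesis passes to the leading coefficient of \<open>A\<close>, which is therefore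
  divisible by \<open>g\<close>. The leading term can then be removed without losing the
  hypothesis.\<close>

lemma mpoly_poly_dvd_of_powers:
  fixes g c :: "('v::{finite,linorder}, 'a::field) mpoly"
  assumes "\<And>n. [:g:] ^ n dvd [:c:] * A ^ n" "c \<noteq> 0"
  shows "[:g:] dvd A"
  using assms(1)
proof (induction "degree A" arbitrary: A rule: less_induct)
  case less
  have "g ^ n dvd c * lead_coeff A ^ n" for n
  proof -
    have "[:g ^ n:] dvd [:c:] * A ^ n" using less.prems[of n] by (simp add: poly_const_pow)
    then have "g ^ n dvd lead_coeff ([:c:] * A ^ n)" by (simp only: const_poly_dvd_iff)
    then show ?thesis using assms(2) by (simp add: lead_coeff_mult lead_coeff_power)
  qed
  then have g: "g dvd lead_coeff A" using assms(2) by (rule mpoly_dvd_of_powers)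
  define M where "M = monom (lead_coeff A) (degree A)"
  have M: "[:g:] dvd M" using g by (auto simp: const_poly_dvd_iff M_def)
  have "[:g:] dvd A - M"
  proof (cases "degree A = 0")
    case True
    then have "A - M = 0" by (auto simp: M_def monom_0 elim: degree_eq_zeroE)
    then show ?thesis by simp
  next
    case False
    have "degree (A - M) < degree A"
    proof (rule degree_lessI)
      show "\<forall>k\<ge>degree A. coeff (A - M) k = 0"
        by (auto simp: M_def coeff_eq_0)
    qed (use False in auto)
    \<comment> \<open>In each binomial term, \<open>[:c:] * A ^ k\<close> supplies \<open>k\<close>
      factors \<open>g\<close> by hypothesis, and the power of \<open>M\<close> supplies the other
      \<open>n - k\<close>.\<close>
    moreover have "[:g:] ^ n dvd [:c:] * (A - M) ^ n" for n
    proof -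
      have "[:g:] ^ n dvd [:c:] * (of_nat (n choose k) * A ^ k * (- M) ^ (n - k))" if "k \<le> n" for k
      proof -
        have "[:g:] ^ k * [:g:] ^ (n - k) dvd ([:c:] * A ^ k) * (- M) ^ (n - k)"
          using M by (intro mult_dvd_mono less.prems dvd_power_same) auto
        then have "[:g:] ^ n dvd ([:c:] * A ^ k) * (- M) ^ (n - k)"
          using that by (simp flip: power_add)
        then have "[:g:] ^ n dvd of_nat (n choose k) * (([:c:] * A ^ k) * (- M) ^ (n - k))"
          by (rule dvd_mult)
        then show ?thesis by (simp add: mult_ac)
      qed
      then have "[:g:] ^ n dvd (\<Sum>k\<le>n. [:c:] * (of_nat (n choose k) * A ^ k * (- M) ^ (n - k)))"
        by (intro dvd_sum) auto
      also have "\<dots> = [:c:] * (A + - M) ^ n"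
        unfolding binomial_ring sum_distrib_left ..
      finally show ?thesis by simp
    qed
    ultimately show ?thesis by (rule less.hyps)
  qed
  then show ?case using M by (metis diff_add_cancel dvd_add)
qed

text \<open>Whole blocks of \<open>k\<close> factors divide by hypothesis and the remaining
  \<open>n mod k\<close> factors are absorbed by \<open>g ^ k\<close>, a common denominator of all
  powers of \<open>A / g\<close>.\<close>

lemma mpoly_power_dvd_powerD:
  fixes g A :: "('v::{finite,linorder}, 'a::field) mpoly"
  assumes "g ^ k dvd A ^ k" "k > 0"
  shows "g dvd A"
proof (cases "g = 0")
  case True
  then show ?thesis using assms by (simp add: power_0_left)
next
  case False
  have "g ^ n dvd g ^ k * A ^ n" for n
  proof -
    have "g ^ (k * (n div k)) dvd A ^ (k * (n div k))"
      unfolding power_mult using assms(1) by (rule dvd_power_same)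
    moreover have "g ^ (n mod k) dvd g ^ k"
      using assms(2) by (intro le_imp_power_dvd) simp
    ultimately have "g ^ (n mod k) * g ^ (k * (n div k)) dvd g ^ k * (A ^ (k * (n div k)) * A ^ (n mod k))"
      by (intro mult_dvd_mono dvd_mult2) auto
    then show ?thesis by (simp flip: power_add)
  qed
  then show ?thesis using False by (intro mpoly_dvd_of_powers[of g "g ^ k"]) auto
qed

text \<open>Division by \<open>g ^ k\<close> shows \<open>A / g\<close> to be integral: the sum of
  the \<open>e l * (A / g) ^ l\<close> is \<open>B\<close>, and \<open>e k\<close> is a unit. Hence
  all its powers have the common denominator \<open>g ^ k\<close>, by reducing exponents
  \<open>n \<ge> k\<close> through the equation.\<close>

lemma homogenized_root_dvd:
  fixes g :: "('v::{finite,linorder}, 'a::field) mpoly"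
  assumes eq: "(\<Sum>l\<le>k. [:e l * g ^ (k - l):] * A ^ l) = [:g ^ k:] * B"
    and unit: "e k dvd 1" and g: "g \<noteq> 0" and k: "k > 0"
  shows "[:g:] dvd A"
proof (rule mpoly_poly_dvd_of_powers)
  show "g ^ k \<noteq> 0" using g by simp
  fix n
  show "[:g:] ^ n dvd [:g ^ k:] * A ^ n"
  proof (induction n rule: less_induct)
    case (less n)
    show ?case
    proof (cases "n < k")
      case True
      then show ?thesis
        by (intro dvd_mult2) (simp add: poly_const_pow le_imp_power_dvd)
    next
      case False
      have *: "[:g:] ^ n dvd [:g ^ k:] * A ^ (n - k) * ([:e l * g ^ (k - l):] * A ^ l)" if "l < k" for l
      proof -
        have "[:g:] ^ (n - k + l) * [:g:] ^ (k - l) dvd ([:g ^ k:] * A ^ (n - k + l)) * [:e l * g ^ (k - l):]"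
          using that False by (intro mult_dvd_mono less.IH) (auto simp: poly_const_pow)
        then have "[:g:] ^ (n - k + l + (k - l)) dvd [:g ^ k:] * A ^ (n - k) * ([:e l * g ^ (k - l):] * A ^ l)"
          by (simp only: power_add mult_ac)
        moreover have "n - k + l + (k - l) = n" using that False by simp
        ultimately show ?thesis by metis
      qed
      have **: "[:g:] ^ n dvd [:g ^ k:] * A ^ (n - k) * ([:g ^ k:] * B)"
      proof -
        have "[:g:] ^ (n - k) * [:g:] ^ k dvd ([:g ^ k:] * A ^ (n - k)) * ([:g ^ k:] * B)"
          using k False by (intro mult_dvd_mono less.IH dvd_mult2) (auto simp: poly_const_pow)
        then show ?thesis using False by (simp flip: power_add)
      qed
      \<comment> \<open>The equation, multiplied by \<open>[:g ^ k:] * A ^ (n - k)\<close>, is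
        solved for its top term; every other term is already known to be divisible.\<close>
      have "[:g ^ k:] * A ^ (n - k) * ([:e k:] * A ^ k)
         = [:g ^ k:] * A ^ (n - k) * ([:g ^ k:] * B) - (\<Sum>l<k. [:g ^ k:] * A ^ (n - k) * ([:e l * g ^ (k - l):] * A ^ l))"
        unfolding eq[symmetric] sum_distrib_left[symmetric] by (simp add: lessThan_Suc_atMost[symmetric] algebra_simps)
      also have "[:g:] ^ n dvd \<dots>"
        using * ** by (intro dvd_diff dvd_sum) auto
      finally have "[:g:] ^ n dvd [:e k:] * ([:g ^ k:] * A ^ n)"
        using False by (simp add: mult_ac power_add[symmetric])
      moreover have "[:e k:] dvd 1"
        using unit const_poly_dvd_const_poly_iff[of "e k" 1] by (simp only: one_pCons)
      ultimately show ?thesis by (rule dvd_cancel_unit[rotated])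
    qed
  qed
qed

section \<open>Division in two variables over the fraction field\<close>

lemma map_poly_hom_add:
  assumes "f 0 = 0" "\<And>x y. f (x + y) = f x + f y"
  shows "map_poly f (p + q) = map_poly f p + map_poly f q"
  by (rule poly_eqI) (simp add: coeff_map_poly assms)

lemma map_poly_hom_mult:
  fixes f :: "'r::comm_semiring_1 \<Rightarrow> 's::comm_semiring_1"
  assumes "f 0 = 0" "\<And>x y. f (x + y) = f x + f y" "\<And>x y. f (x * y) = f x * f y"
  shows "map_poly f (p * q) = map_poly f p * map_poly f q"
proof -
  have "f (sum g A) = (\<Sum>x\<in>A. f (g x))" for g and A :: "nat set"
    by (induction A rule: infinite_finite_induct) (auto simp: assms)
  then show ?thesis by (intro poly_eqI) (simp add: coeff_mult coeff_map_poly assms)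
qed

lemma in_s_simps [simp]: "in_s 0 = 0" "in_s 1 = 1" "in_s (a + b) = in_s a + in_s b"
    "in_s (a * b) = in_s a * in_s b"
  by (auto simp: in_s_def one_pCons mult.commute)

lemma in_s_diff: "in_s (a - b) = in_s a - in_s b"
  for a b :: "'r::comm_ring_1 poly"
  by (simp add: in_s_def)

lemma coeff_in_t: "coeff (in_t B) j = [:coeff B j:]"
  by (simp add: in_t_def coeff_map_poly)

lemma in_t_simps [simp]: "in_t 0 = 0" "in_t 1 = 1" "in_t (a + b) = in_t a + in_t b"
    "in_t (a * b) = in_t a * in_t b"
  unfolding in_t_def
  by (auto intro: map_poly_hom_add map_poly_hom_mult simp: one_pCons map_poly_pCons mult.commute)

lemma in_t_diff: "in_t (a - b) = in_t a - in_t b"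
  for a b :: "'r::comm_ring_1 poly"
  by (rule poly_eqI) (simp add: coeff_in_t)

lemma coeff_coeff_mult: "coeff (coeff (Q * P) j) i =
    (\<Sum>a\<le>i. \<Sum>b\<le>j. coeff (coeff Q b) a * coeff (coeff P (j - b)) (i - a))"
  by (simp add: coeff_mult coeff_sum) (rule sum.swap)

text \<open>This exchanges \<open>s\<close> and \<open>t\<close>: \<open>in_t\<close> moves the
  inner variable outside, and the outer one is evaluated at the inner one. As an evaluation it is
  visibly multiplicative.\<close>

definition swap_st :: "'r::comm_ring_1 poly poly \<Rightarrow> 'r poly poly" where
  "swap_st Q = poly (map_poly in_t Q) [:[:0, 1:]:]"

lemma coeff_swap_st: "coeff (coeff (swap_st Q) i) j = coeff (coeff Q j) i"
proof (induction Q arbitrary: j)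
  case (pCons a Q)
  have "swap_st (pCons a Q) = in_t a + smult [:0, 1:] (swap_st Q)"
    by (simp add: swap_st_def map_poly_pCons)
  then show ?case using pCons.IH by (cases j) (auto simp: coeff_in_t)
qed (simp add: swap_st_def)

lemma swap_st_mult: "swap_st (Q * P) = swap_st Q * swap_st P"
  unfolding swap_st_def by (subst map_poly_hom_mult) auto

lemma swap_st_in_t: "swap_st (in_t B) = in_s B"
  by (intro poly_eqI) (simp add: coeff_swap_st coeff_in_t in_s_def coeff_pCons split: nat.splits)

text \<open>Since \<open>P\<close> has positive degree in \<open>t\<close>, so does each of its
  nonzero multiples.\<close>

lemma in_s_multiple_eq_0:
  fixes A :: "'r::idom poly"
  assumes "P dvd in_s A" "coeff P j \<noteq> 0" "j > 0"
  shows "A = 0"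
proof -
  obtain Q where Q: "in_s A = P * Q" using assms(1) by (elim dvdE)
  have "degree P > 0" using assms(2,3) le_degree[of P j] by simp
  moreover have "degree (P * Q) = 0" unfolding Q[symmetric] by (simp add: in_s_def)
  ultimately have "P = 0 \<or> Q = 0"
    by (metis add_is_0 degree_mult_eq less_numeral_extra(3))
  then have "in_s A = 0" using Q by auto
  then show ?thesis by (simp add: in_s_def)
qed

lemma in_t_multiple_eq_0:
  fixes B :: "'r::idom poly"
  assumes "P dvd in_t B" "coeff (coeff P j) i \<noteq> 0" "i > 0"
  shows "B = 0"
proof (rule in_s_multiple_eq_0)
  obtain Q where "in_t B = P * Q" using assms(1) by (elim dvdE)
  then have "in_s B = swap_st P * swap_st Q"
    by (simp flip: swap_st_mult swap_st_in_t)
  then show "swap_st P dvd in_s B" by simp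
  show "coeff (swap_st P) i \<noteq> 0"
    using assms(2) by (metis coeff_swap_st coeff_0)
qed (use assms in simp)

lemma ideal_of_singleton: "ideal_of {p} = {x. p dvd x}"
proof -
  interpret module "(*) :: 'a \<Rightarrow> 'a \<Rightarrow> 'a"
    by unfold_locales (auto simp: algebra_simps)
  show ?thesis by (auto simp: ideal_of_def span_singleton dvd_def mult.commute)
qed

text \<open>If no coefficient of \<open>s^0\<close> survives in \<open>P\<close>, then setting
  \<open>s = 0\<close> in \<open>A - B = P Q\<close> makes \<open>B\<close> the constant
  \<open>A(0)\<close>. Now \<open>P\<close>, which involves \<open>t\<close>, divides the polynomial
  \<open>A - A(0)\<close> in \<open>s\<close>, so \<open>A\<close> is the same constant and the pair
  is trivial. The other claim exchanges \<open>s\<close> and \<open>t\<close>.\<close>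

lemma alg_st_nontrivial:
  fixes P :: "'k::field poly poly"
  assumes nontriv: "\<not> trivial_algebra (\<lambda>c. [:c:]) (alg_st {D. P dvd D})"
    and s: "coeff (coeff P j1) i1 \<noteq> 0" "i1 > 0" and t: "coeff P j2 \<noteq> 0" "j2 > 0"
  shows "\<exists>j. coeff (coeff P j) 0 \<noteq> 0" "\<exists>i. coeff (coeff P 0) i \<noteq> 0"
proof -
  obtain A B where AB: "P dvd in_s A - in_t B" "\<And>c. A = [:c:] \<Longrightarrow> B = [:c:] \<Longrightarrow> False"
    using nontriv by (force simp: trivial_algebra_def alg_st_def)
  obtain Q where Q: "in_s A - in_t B = P * Q" using AB(1) by (elim dvdE)
  have in_st: "in_s [:c:] = in_t [:c:]" for c :: 'k
    by (simp add: in_s_def in_t_def map_poly_pCons)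
  show "\<exists>j. coeff (coeff P j) 0 \<noteq> 0"
  proof (rule ccontr)
    assume "\<not> (\<exists>j. coeff (coeff P j) 0 \<noteq> 0)"
    then have 0: "coeff (coeff (in_s A - in_t B) j) 0 = 0" for j
      unfolding Q coeff_coeff_mult by simp
    have B: "B = [:coeff A 0:]"
    proof (rule poly_eqI)
      fix j show "coeff B j = coeff [:coeff A 0:] j"
        using 0[of j] by (cases j) (auto simp: coeff_in_t in_s_def)
    qed
    then have "P dvd in_s (A - [:coeff A 0:])"
      using AB(1) by (simp add: in_s_diff in_st)
    then have "A - [:coeff A 0:] = 0" using t by (rule in_s_multiple_eq_0)
    then have "A = [:coeff A 0:]" by simp
    from AB(2)[OF this B] show False .
  qed
  show "\<exists>i. coeff (coeff P 0) i \<noteq> 0"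
  proof (rule ccontr)
    assume "\<not> (\<exists>i. coeff (coeff P 0) i \<noteq> 0)"
    then have "coeff P 0 = 0" by (auto intro: poly_eqI)
    then have "coeff (in_s A - in_t B) 0 = 0"
      unfolding Q by (simp add: coeff_mult)
    then have A: "A = [:coeff B 0:]"
      by (simp add: in_s_def coeff_in_t)
    then have "P dvd in_t ([:coeff B 0:] - B)"
      using AB(1) by (metis in_t_diff in_st)
    then have "[:coeff B 0:] - B = 0" using s by (rule in_t_multiple_eq_0)
    then have "B = [:coeff B 0:]" by simp
    from AB(2)[OF A this] show False .
  qed
qed

section \<open>Subrings and localizations\<close>

definition closed_ring :: "'r::comm_ring_1 set \<Rightarrow> bool" where
  "closed_ring S \<longleftrightarrow> 0 \<in> S \<and> 1 \<in> S \<and> (\<forall>x\<in>S. \<forall>y\<in>S. x + y \<in> S \<and> x - y \<in> S \<and> x * y \<in> S)"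

lemma closed_ringD:
  assumes "closed_ring S"
  shows "0 \<in> S" "1 \<in> S" "x \<in> S \<Longrightarrow> y \<in> S \<Longrightarrow> x + y \<in> S" "x \<in> S \<Longrightarrow> y \<in> S \<Longrightarrow> x - y \<in> S"
    "x \<in> S \<Longrightarrow> y \<in> S \<Longrightarrow> x * y \<in> S"
  using assms by (auto simp: closed_ring_def)

lemma closed_ring_sum: "closed_ring S \<Longrightarrow> (\<And>x. x \<in> A \<Longrightarrow> f x \<in> S) \<Longrightarrow> sum f A \<in> S"
  by (induction A rule: infinite_finite_induct) (auto intro: closed_ringD)

lemma closed_ring_power: "closed_ring S \<Longrightarrow> x \<in> S \<Longrightarrow> x ^ n \<in> S"
  by (induction n) (auto intro: closed_ringD)

text \<open>The quotient of two bivariate polynomials, computed from the lexicographically lowest term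
  of the divisor: only the inverse of that coefficient is needed.\<close>

lemma quotient_coeff_in:
  fixes q r :: "nat \<Rightarrow> nat \<Rightarrow> 'k::field"
  assumes S: "closed_ring S"
    and prod: "\<And>i j. (\<Sum>a\<le>i. \<Sum>b\<le>j. q a b * r (i - a) (j - b)) \<in> S"
    and r: "\<And>i j. r i j \<in> S"
    and low: "\<And>j. j < k \<Longrightarrow> r 0 j = 0" "r 0 k \<noteq> 0" "inverse (r 0 k) \<in> S"
  shows "q i j \<in> S"
proof (induction i arbitrary: j rule: less_induct)
  case i: (less i)
  show ?case
  proof (induction j rule: less_induct)
    case j: (less j)
    \<comment> \<open>The product coefficient at \<open>(i, j + k)\<close> contains
      \<open>q i j * r 0 k\<close>. In row \<open>i\<close> the terms beyond column \<open>j\<close>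
      vanish by the minimality of \<open>k\<close>; all others involve quotient coefficients already
      shown to be in \<open>S\<close>.\<close>
    let ?t = "\<lambda>a b. q a b * r (i - a) (j + k - b)"
    have "(\<Sum>a\<le>i. \<Sum>b\<le>j + k. ?t a b) = (\<Sum>b\<le>j + k. ?t i b) + (\<Sum>a<i. \<Sum>b\<le>j + k. ?t a b)"
      by (simp add: lessThan_Suc_atMost[symmetric])
    also have "(\<Sum>b\<le>j + k. ?t i b) = (\<Sum>b\<le>j. ?t i b)"
      using low(1) by (intro sum.mono_neutral_right) auto
    also have "\<dots> = ?t i j + (\<Sum>b<j. ?t i b)"
      by (simp add: lessThan_Suc_atMost[symmetric])
    finally have eq: "q i j * r 0 k = (\<Sum>a\<le>i. \<Sum>b\<le>j + k. ?t a b)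
        - (\<Sum>a<i. \<Sum>b\<le>j + k. ?t a b) - (\<Sum>b<j. ?t i b)" by simp
    have "q i j * r 0 k \<in> S"
      unfolding eq using i.IH j.IH r
      by (intro closed_ringD[OF S] prod closed_ring_sum[OF S]) auto
    then have "q i j * r 0 k * inverse (r 0 k) \<in> S"
      using low(3) by (rule closed_ringD(5)[OF S])
    then show ?case using low(2) by (simp add: field_simps)
  qed
qed

text \<open>For nonzero \<open>u\<close> this is the ring \<open>R[1/u]\<close> inside the fraction
  field, described with denominators cleared.\<close>

definition localization :: "'r::idom \<Rightarrow> 'r fract set" where
  "localization u = {x. \<exists>n r. x * to_fract u ^ n = to_fract r}"

lemma to_fract_power: "to_fract (x ^ n) = to_fract x ^ n"
  by (induction n) auto

lemma to_fract_in_localization: "to_fract x \<in> localization u"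
proof -
  have "to_fract x * to_fract u ^ 0 = to_fract x" by simp
  then show ?thesis unfolding localization_def by blast
qed

lemma inverse_in_localization:
  assumes "u \<noteq> 0"
  shows "inverse (to_fract u) \<in> localization u"
proof -
  have "inverse (to_fract u) * to_fract u ^ 1 = to_fract 1" using assms by simp
  then show ?thesis unfolding localization_def by blast
qed

lemma closed_ring_localization: "closed_ring (localization u)"
proof -
  have "x + y \<in> localization u \<and> x - y \<in> localization u \<and> x * y \<in> localization u"
    if xy: "x \<in> localization u" "y \<in> localization u" for x y
  proof -
    obtain n r where x: "x * to_fract u ^ n = to_fract r" using xy by (auto simp: localization_def)
    obtain m s where y: "y * to_fract u ^ m = to_fract s" using xy by (auto simp: localization_def)
    have "(x + y) * to_fract u ^ (n + m) = to_fract (r * u ^ m + s * u ^ n)"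
      "(x - y) * to_fract u ^ (n + m) = to_fract (r * u ^ m - s * u ^ n)"
      "(x * y) * to_fract u ^ (n + m) = to_fract (r * s)"
      by (simp_all add: power_add to_fract_power algebra_simps flip: x y)
    then show ?thesis unfolding localization_def by blast
  qed
  then show ?thesis
    using to_fract_in_localization[of 0 u] to_fract_in_localization[of 1 u] by (simp add: closed_ring_def)
qed

text \<open>Two expressions \<open>r / u^n = s / v^m\<close> give that \<open>u^n\<close> divides
  \<open>v^m r\<close>, and coprimality removes the factor \<open>v^m\<close>.\<close>

lemma localization_Int:
  fixes u v :: "('v::{finite,linorder}, 'a::field) mpoly"
  assumes "u \<in> polys_in V" "v \<in> polys_in W" "V \<inter> W = {}" "u \<noteq> 0" "v \<noteq> 0"
    and "x \<in> localization u" "x \<in> localization v"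
  shows "x \<in> range to_fract"
proof -
  obtain n r where r: "x * to_fract u ^ n = to_fract r" using assms by (auto simp: localization_def)
  obtain m s where s: "x * to_fract v ^ m = to_fract s" using assms by (auto simp: localization_def)
  have "to_fract (v ^ m * r) = to_fract (u ^ n * s)"
    by (simp add: to_fract_power flip: r s)
  then have "v ^ m * r = u ^ n * s" unfolding to_fract_eq_iff .
  then have "u ^ n dvd v ^ m * r" by (rule dvdI)
  then have "u ^ n dvd r"
    by (rule dvd_cancel_disjoint[OF polys_in_power[OF assms(1)] polys_in_power[OF assms(2)] assms(3), rotated])
      (use assms(5) in simp)
  then obtain r' where "r = u ^ n * r'" by (elim dvdE)
  then have "x * to_fract u ^ n = to_fract r' * to_fract u ^ n" by (simp add: r to_fract_power)
  then show ?thesis using assms(4) by simp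
qed

section \<open>Descent of divisibility from the fraction field\<close>

abbreviation fract_poly2 :: "'r::idom poly poly \<Rightarrow> 'r fract poly poly" where
  "fract_poly2 \<equiv> map_poly (map_poly to_fract)"

lemma coeff_fract_poly2: "coeff (coeff (fract_poly2 Q) j) i = to_fract (coeff (coeff Q j) i)"
  by (simp add: coeff_map_poly)

lemma fract_poly2_mult: "fract_poly2 (Q * P) = fract_poly2 Q * fract_poly2 P"
  by (rule map_poly_hom_mult) (auto simp: fract_poly_mult)

lemma fract_poly2_eq_iff: "fract_poly2 Q = fract_poly2 P \<longleftrightarrow> Q = P"
  by (simp only: poly_eq_iff coeff_fract_poly2 to_fract_eq_iff)

lemma fract_poly2_preimage:
  assumes "\<And>i j. coeff (coeff Q j) i \<in> range to_fract"
  shows "\<exists>Q'. Q = fract_poly2 Q'"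
proof -
  have inj: "inj (to_fract :: 'a \<Rightarrow> _)" by (auto intro: injI)
  have 0: "inv to_fract (0 :: 'a fract) = 0"
    using inv_f_f[OF inj, of 0] by simp
  have "Q = fract_poly2 (map_poly (map_poly (inv to_fract)) Q)"
    using assms by (intro poly_eqI) (simp add: coeff_map_poly 0 f_inv_into_f)
  then show ?thesis by blast
qed

text \<open>The quotient is computed in two orders. Dividing from the lowest coefficient at
  \<open>s^0\<close> inverts an element of \<open>polys_in W\<close>, dividing from the lowest one
  at \<open>t^0\<close> an element of \<open>polys_in V\<close>. Lying in both localizations, the
  coefficients of the quotient have no denominator.\<close>

lemma fract_poly2_dvdD:
  fixes P D :: "('v::{finite,linorder}, 'a::field) mpoly poly poly"
  assumes dvd: "fract_poly2 P dvd fract_poly2 D"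
    and V: "\<And>i. coeff (coeff P 0) i \<in> polys_in V" "coeff P 0 \<noteq> 0"
    and W: "\<And>j. coeff (coeff P j) 0 \<in> polys_in W" "\<exists>j. coeff (coeff P j) 0 \<noteq> 0"
    and disj: "V \<inter> W = {}"
  shows "P dvd D"
proof -
  obtain Q where Q: "fract_poly2 D = Q * fract_poly2 P" using dvd by (metis dvdE mult.commute)
  obtain i0 where i0: "coeff (coeff P 0) i0 \<noteq> 0" "\<And>i. i < i0 \<Longrightarrow> coeff (coeff P 0) i = 0"
    using LeastI_ex[of "\<lambda>i. coeff (coeff P 0) i \<noteq> 0"] not_less_Least V(2) 
    by (metis (mono_tags, lifting) leading_coeff_0_iff)
  obtain j0 where j0: "coeff (coeff P j0) 0 \<noteq> 0" "\<And>j. j < j0 \<Longrightarrow> coeff (coeff P j) 0 = 0"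
    using LeastI_ex[OF W(2)] not_less_Least by (metis (mono_tags, lifting))
  define r where "r i j = to_fract (coeff (coeff P j) i)" for i j
  have D: "(\<Sum>a\<le>i. \<Sum>b\<le>j. coeff (coeff Q b) a * r (i - a) (j - b)) = to_fract (coeff (coeff D j) i)" for i j
    unfolding r_def coeff_fract_poly2[symmetric] Q coeff_coeff_mult ..
  have "coeff (coeff Q j) i \<in> localization (coeff (coeff P j0) 0)" for i j
  proof (rule quotient_coeff_in[where r = r and k = j0 and q = "\<lambda>i j. coeff (coeff Q j) i", OF closed_ring_localization])
    fix i j
    show "(\<Sum>a\<le>i. \<Sum>b\<le>j. coeff (coeff Q b) a * r (i - a) (j - b)) \<in> localization (coeff (coeff P j0) 0)"
      unfolding D by (rule to_fract_in_localization)
  qed (use j0 in \<open>auto simp: r_def intro: to_fract_in_localization inverse_in_localization\<close>)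
  moreover have "coeff (coeff Q j) i \<in> localization (coeff (coeff P 0) i0)" for i j
  proof (rule quotient_coeff_in[OF closed_ring_localization, where r = "\<lambda>j i. r i j" and k = i0 and q = "\<lambda>j i. coeff (coeff Q j) i"])
    fix i j
    have "(\<Sum>a\<le>i. \<Sum>b\<le>j. coeff (coeff Q a) b * r (j - b) (i - a)) = to_fract (coeff (coeff D i) j)"
      unfolding D[symmetric] by (rule sum.swap)
    then show "(\<Sum>a\<le>i. \<Sum>b\<le>j. coeff (coeff Q a) b * r (j - b) (i - a)) \<in> localization (coeff (coeff P 0) i0)"
      by (simp add: to_fract_in_localization)
  qed (use i0 in \<open>auto simp: r_def intro: to_fract_in_localization inverse_in_localization\<close>)
  ultimately have "coeff (coeff Q j) i \<in> range to_fract" for i j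
    using localization_Int[OF V(1)[of i0] W(1)[of j0] disj i0(1) j0(1)] by blast
  then obtain Q' where "Q = fract_poly2 Q'" using fract_poly2_preimage by blast
  then have "D = Q' * P" using Q by (simp add: fract_poly2_eq_iff flip: fract_poly2_mult)
  then show ?thesis by simp
qed

section \<open>Homogenization\<close>

lemma mpoly_eval_cong:
  assumes "p \<in> polys_in V" "\<And>v. v \<in> V \<Longrightarrow> \<sigma> v = \<tau> v"
  shows "mpoly_eval \<iota> \<sigma> p = mpoly_eval \<iota> \<tau> p"
  unfolding mpoly_eval_def using assms
  by (intro sum.cong arg_cong2[of _ _ _ _ "(*)"] prod.cong arg_cong2[of _ _ _ _ "(^)"])
    (auto simp: polys_in_def)

text \<open>Multiplies each variable by one new variable. That variable plays the role of
  \<open>s\<close> for polynomials in \<open>X\<close> and of \<open>t\<close> for those in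
  \<open>Y\<close>.\<close>

definition homog :: "('v, 'a::comm_semiring_1) mpoly \<Rightarrow> ('v, 'a) mpoly poly" where
  "homog = mpoly_eval (\<lambda>c. [:mconst c:]) (\<lambda>v. monom (mvar v) 1)"

text \<open>This is \<open>phi\<close> before passage to the fraction field, kept separately in
  order to speak of divisibility with coefficients in \<open>R\<close>.\<close>

definition bihomog :: "'v set \<Rightarrow> ('v, 'a::comm_semiring_1) mpoly \<Rightarrow> ('v, 'a) mpoly poly poly" where
  "bihomog X = mpoly_eval (\<lambda>c. const_st (mconst c))
     (\<lambda>v. (if v \<in> X then in_s [:0, 1:] else in_t [:0, 1:]) * const_st (mvar v))"

global_interpretation bihomog: mpoly_hom "\<lambda>c. const_st (mconst c)"
    "\<lambda>v. (if v \<in> X then in_s [:0, 1:] else in_t [:0, 1:]) * const_st (mvar v)"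
  rewrites "mpoly_eval (\<lambda>c. const_st (mconst c))
     (\<lambda>v. (if v \<in> X then in_s [:0, 1:] else in_t [:0, 1:]) * const_st (mvar v)) = bihomog X"
  for X :: "'v set"
  by unfold_locales (auto simp: const_st_def mconst_add mconst_mult one_pCons bihomog_def mult.commute)

lemma in_t_X: "in_t [:0, 1:] = [:0, 1:]"
  by (simp add: in_t_def map_poly_pCons one_pCons)

lemma bihomog_diff: "bihomog X (p - q) = bihomog X p - bihomog X q"
  for p q :: "('v, 'a::comm_ring_1) mpoly"
  using bihomog.eval_add[of X "p - q" q] by simp

lemma phi_eq_bihomog: "phi X p = fract_poly2 (bihomog X p)"
proof -
  have "fract_poly2 (bihomog X p) = mpoly_eval (fract_poly2 \<circ> (\<lambda>c. const_st (mconst c)))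
     (fract_poly2 \<circ> (\<lambda>v. (if v \<in> X then in_s [:0, 1:] else in_t [:0, 1:]) * const_st (mvar v))) p"
    unfolding bihomog_def
    by (rule mpoly_eval_hom_comp) (auto intro: map_poly_hom_add fract_poly2_mult)
  also have "\<dots> = phi X p"
    unfolding phi_def
    by (intro arg_cong2[of _ _ _ _ "\<lambda>a b. mpoly_eval a b p"])
      (auto simp: fun_eq_iff const_st_def fract_poly2_mult map_poly_pCons in_s_def in_t_X)
  finally show ?thesis ..
qed

lemma poly_homog_1: "poly (homog f) 1 = f"
proof -
  have "poly (homog f) 1 = mpoly_eval ((\<lambda>q. poly q 1) \<circ> (\<lambda>c. [:mconst c:]))
      ((\<lambda>q. poly q 1) \<circ> (\<lambda>v. monom (mvar v) 1)) f"
    unfolding homog_def by (rule mpoly_eval_hom_comp) auto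
  also have "\<dots> = mpoly_eval mconst mvar f"
    by (intro arg_cong2[of _ _ _ _ "\<lambda>a b. mpoly_eval a b f"]) (auto simp: fun_eq_iff poly_monom)
  finally show ?thesis by (simp add: mpoly_eval_mconst_mvar)
qed

lemma poly_bihomog_1: "poly (poly (bihomog X p) 1) 1 = p"
proof -
  have "poly (poly (bihomog X p) 1) 1 = mpoly_eval ((\<lambda>q. poly (poly q 1) 1) \<circ> (\<lambda>c. const_st (mconst c)))
      ((\<lambda>q. poly (poly q 1) 1) \<circ> (\<lambda>v. (if v \<in> X then in_s [:0, 1:] else in_t [:0, 1:]) * const_st (mvar v))) p"
    unfolding bihomog_def by (rule mpoly_eval_hom_comp) auto
  also have "\<dots> = mpoly_eval mconst mvar p"
    by (intro arg_cong2[of _ _ _ _ "\<lambda>a b. mpoly_eval a b p"])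
      (auto simp: fun_eq_iff const_st_def in_s_def in_t_X)
  finally show ?thesis by (simp add: mpoly_eval_mconst_mvar)
qed

lemma bihomog_in_s:
  assumes "f \<in> polys_in X"
  shows "bihomog X f = in_s (homog f)"
proof -
  have "in_s (homog f) = mpoly_eval (in_s \<circ> (\<lambda>c. [:mconst c:])) (in_s \<circ> (\<lambda>v. monom (mvar v) 1)) f"
    unfolding homog_def by (rule mpoly_eval_hom_comp) auto
  also have "in_s \<circ> (\<lambda>c. [:mconst c:]) = (\<lambda>c. const_st (mconst c))"
    by (auto simp: in_s_def const_st_def)
  also have "mpoly_eval \<dots> (in_s \<circ> (\<lambda>v. monom (mvar v) 1)) f = bihomog X f"
    unfolding bihomog_def using assms
    by (rule mpoly_eval_cong) (auto simp: in_s_def const_st_def monom_Suc monom_0)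
  finally show ?thesis ..
qed

lemma bihomog_in_t:
  assumes "f \<in> polys_in Y" "X \<inter> Y = {}"
  shows "bihomog X f = in_t (homog f)"
proof -
  have "in_t (homog f) = mpoly_eval (in_t \<circ> (\<lambda>c. [:mconst c:])) (in_t \<circ> (\<lambda>v. monom (mvar v) 1)) f"
    unfolding homog_def by (rule mpoly_eval_hom_comp) auto
  also have "in_t \<circ> (\<lambda>c. [:mconst c:]) = (\<lambda>c. const_st (mconst c))"
    by (auto simp: in_t_def const_st_def map_poly_pCons)
  also have "mpoly_eval \<dots> (in_t \<circ> (\<lambda>v. monom (mvar v) 1)) f = bihomog X f"
    unfolding bihomog_def using assms(1)
    by (rule mpoly_eval_cong)
      (use assms(2) in \<open>auto simp: in_t_def const_st_def monom_Suc monom_0 map_poly_pCons one_pCons\<close>)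
  finally show ?thesis ..
qed

text \<open>The right-hand side is the homogeneous component of \<open>f\<close> of degree
  \<open>i\<close>.\<close>

lemma coeff_homog:
  fixes f :: "('v, 'a::comm_semiring_1) mpoly"
  shows "coeff (homog f) i = (\<Sum>m\<in>Poly_Mapping.keys f.
     if (\<Sum>v\<in>Poly_Mapping.keys m. Poly_Mapping.lookup m v) = i then Poly_Mapping.single m (Poly_Mapping.lookup f m) else 0)"
proof -
  have "(\<Prod>v\<in>A. monom (mvar v :: ('v, 'a) mpoly) 1 ^ Poly_Mapping.lookup m v)
    = monom (\<Prod>v\<in>A. mvar v ^ Poly_Mapping.lookup m v) (\<Sum>v\<in>A. Poly_Mapping.lookup m v)" for A m
    by (induction A rule: infinite_finite_induct) (auto simp: monom_power mult_monom monom_0 one_pCons)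
  then have "mono_eval (\<lambda>v. monom (mvar v :: ('v, 'a) mpoly) 1) m
    = monom (Poly_Mapping.single m 1) (\<Sum>v\<in>Poly_Mapping.keys m. Poly_Mapping.lookup m v)" for m
    by (simp add: mono_eval_def mono_eval_mvar[unfolded mono_eval_def])
  then show ?thesis
    unfolding homog_def mpoly_eval_altdef
    by (auto simp: coeff_sum mconst_def mult_single smult_monom coeff_monom intro!: sum.cong)
qed

lemma coeff_homog_in:
  assumes "f \<in> polys_in V"
  shows "coeff (homog f) i \<in> polys_in V"
  unfolding coeff_homog using assms by (intro polys_in_sum) (auto simp: polys_in_def)

text \<open>A homogenization of degree zero equals its value \<open>f\<close> at 1, so
  \<open>f\<close> is its own component of degree zero, and a monomial of degree zero involves no
  variable.\<close>

lemma degree_homog_eq_0D: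
  assumes "degree (homog f) = 0"
  shows "f \<in> range mconst"
proof -
  have "f = coeff (homog f) 0"
    using poly_homog_1[of f] assms by (auto elim!: degree_eq_zeroE)
  also have "\<dots> \<in> polys_in {}"
    unfolding coeff_homog
  proof (intro polys_in_sum)
    fix m :: "'a \<Rightarrow>\<^sub>0 nat"
    have "Poly_Mapping.keys m = {}" if "(\<Sum>v\<in>Poly_Mapping.keys m. Poly_Mapping.lookup m v) = 0"
    proof (rule equals0I)
      fix v assume v: "v \<in> Poly_Mapping.keys m"
      then show False
        using member_le_sum[OF v, of "Poly_Mapping.lookup m"] that by (simp add: in_keys_iff)
    qed
    then show "(if (\<Sum>v\<in>Poly_Mapping.keys m. Poly_Mapping.lookup m v) = 0
      then Poly_Mapping.single m (Poly_Mapping.lookup f m) else 0) \<in> polys_in {}"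
      by (auto simp: polys_in_def)
  qed
  finally show ?thesis by (simp add: polys_in_empty)
qed

text \<open>The right-hand side is the component of \<open>p\<close> of degree \<open>i\<close> in
  the variables of \<open>X\<close> and degree \<open>j\<close> in the others.\<close>

lemma coeff_bihomog:
  fixes p :: "('v, 'a::comm_semiring_1) mpoly"
  shows "coeff (coeff (bihomog X p) j) i = (\<Sum>m\<in>Poly_Mapping.keys p.
     if (\<Sum>v\<in>Poly_Mapping.keys m \<inter> X. Poly_Mapping.lookup m v) = i
       \<and> (\<Sum>v\<in>Poly_Mapping.keys m - X. Poly_Mapping.lookup m v) = j
     then Poly_Mapping.single m (Poly_Mapping.lookup p m) else 0)"
proof -
  let ?\<sigma> = "\<lambda>v. (if v \<in> X then in_s [:0, 1:] else in_t [:0, 1:]) * const_st (mvar v :: ('v, 'a) mpoly)"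
  have \<sigma>: "?\<sigma> v = monom (monom (mvar v) (if v \<in> X then 1 else 0)) (if v \<in> X then 0 else 1)" for v
    by (auto simp: in_s_def in_t_X const_st_def monom_0 monom_Suc)
  have "(\<Prod>v\<in>A. ?\<sigma> v ^ Poly_Mapping.lookup m v)
    = monom (monom (\<Prod>v\<in>A. mvar v ^ Poly_Mapping.lookup m v) (\<Sum>v\<in>A \<inter> X. Poly_Mapping.lookup m v))
        (\<Sum>v\<in>A - X. Poly_Mapping.lookup m v)" if "finite A" for A m
    using that unfolding \<sigma>
    by induction (auto simp: monom_power mult_monom monom_0 one_pCons insert_Diff_if)
  then have "mono_eval ?\<sigma> m = monom (monom (Poly_Mapping.single m 1)
      (\<Sum>v\<in>Poly_Mapping.keys m \<inter> X. Poly_Mapping.lookup m v)) (\<Sum>v\<in>Poly_Mapping.keys m - X. Poly_Mapping.lookup m v)" for m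
    by (simp add: mono_eval_def mono_eval_mvar[unfolded mono_eval_def])
  then show ?thesis
    unfolding bihomog_def mpoly_eval_altdef
    by (auto simp: coeff_sum const_st_def mconst_def mult_single smult_monom coeff_monom intro!: sum.cong)
qed

lemma coeff_bihomog_0_in_polys_in: "coeff (coeff (bihomog X p) 0) i \<in> polys_in X"
  unfolding coeff_bihomog by (intro polys_in_sum) (auto simp: polys_in_def)

lemma coeff_0_bihomog_in_polys_in:
  assumes "X \<union> Y = UNIV"
  shows "coeff (coeff (bihomog X p) j) 0 \<in> polys_in Y"
  unfolding coeff_bihomog using assms by (intro polys_in_sum) (auto simp: polys_in_def)

lemma poly_in_polys_in:
  fixes F :: "('v, 'a::comm_semiring_1) mpoly poly"
  shows "(\<And>i. coeff F i \<in> polys_in V) \<Longrightarrow> poly F 1 \<in> polys_in V"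
  by (simp add: poly_altdef polys_in_sum)

text \<open>Without positive powers of \<open>t\<close>, the value \<open>p\<close> at
  \<open>s = t = 1\<close> would be a sum of coefficients at \<open>t^0\<close>, and these lie in
  \<open>polys_in X\<close>.\<close>

lemma bihomog_not_in_X:
  fixes p :: "('v, 'a::comm_ring_1) mpoly"
  assumes "p \<notin> polys_in X"
  shows "\<exists>j>0. coeff (bihomog X p) j \<noteq> 0"
proof (rule ccontr)
  assume "\<not> (\<exists>j>0. coeff (bihomog X p) j \<noteq> 0)"
  then have "coeff (bihomog X p) j = coeff [:coeff (bihomog X p) 0:] j" for j
    by (cases j) auto
  then have "bihomog X p = [:coeff (bihomog X p) 0:]" by (rule poly_eqI)
  then have "poly (bihomog X p) 1 = coeff (bihomog X p) 0" by (metis poly_const_conv)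
  then have "p = poly (coeff (bihomog X p) 0) 1" using poly_bihomog_1[of X p] by simp
  moreover have "poly (coeff (bihomog X p) 0) 1 \<in> polys_in X"
    by (intro poly_in_polys_in coeff_bihomog_0_in_polys_in)
  ultimately show False using assms by simp
qed

lemma bihomog_not_in_Y:
  fixes p :: "('v, 'a::comm_ring_1) mpoly"
  assumes "p \<notin> polys_in Y" "X \<union> Y = UNIV"
  shows "\<exists>i>0. \<exists>j. coeff (coeff (bihomog X p) j) i \<noteq> 0"
proof (rule ccontr)
  assume "\<not> (\<exists>i>0. \<exists>j. coeff (coeff (bihomog X p) j) i \<noteq> 0)"
  then have 0: "\<And>i j. i > 0 \<Longrightarrow> coeff (coeff (bihomog X p) j) i = 0"
    by blast
  have "poly (coeff (bihomog X p) j) 1 = coeff (coeff (bihomog X p) j) 0" for j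
  proof -
    have "coeff (bihomog X p) j = [:coeff (coeff (bihomog X p) j) 0:]"
      using 0[of _ j] by (intro poly_eqI) (auto simp: coeff_pCons split: nat.splits)
    then show ?thesis by (metis poly_const_conv)
  qed
  then have "poly (poly (bihomog X p) 1) 1 = (\<Sum>j\<le>degree (bihomog X p). coeff (coeff (bihomog X p) j) 0)"
    by (simp add: poly_altdef[of "bihomog X p"] poly_sum)
  also have "\<dots> \<in> polys_in Y"
    by (intro polys_in_sum coeff_0_bihomog_in_polys_in assms)
  finally show False using assms(1) by (simp add: poly_bihomog_1)
qed

section \<open>Compositions with coefficients in a subfield\<close>

text \<open>Only bounds on the degrees enter, so the coefficients at the bounds may well be
  zero.\<close>

lemma coeff_mult_at_bounds:
  fixes p q :: "'r::comm_semiring_1 poly"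
  assumes "degree p \<le> a" "degree q \<le> b"
  shows "coeff (p * q) (a + b) = coeff p a * coeff q b"
proof -
  have "coeff p i * coeff q (a + b - i) = 0" if "i \<noteq> a" for i
    using that assms by (cases "i < a") (auto simp: coeff_eq_0)
  then have "coeff (p * q) (a + b) = (\<Sum>i\<in>{a}. coeff p i * coeff q (a + b - i))"
    unfolding coeff_mult by (intro sum.mono_neutral_right) auto
  then show ?thesis by simp
qed

text \<open>This isolates the linear term \<open>(n + 1) U^n W\<close> of the binomial expansion:
  terms with more factors \<open>W\<close> have smaller degree because \<open>i < d\<close>.\<close>

lemma power_add_minus_power_top:
  fixes U W :: "'r::comm_ring_1 poly"
  assumes U: "degree U \<le> d" and W: "degree W \<le> i" and "i < d"
  shows "degree ((U + W) ^ Suc n - U ^ Suc n) \<le> d * n + i \<and>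
    coeff ((U + W) ^ Suc n - U ^ Suc n) (d * n + i) = of_nat (Suc n) * coeff U d ^ n * coeff W i"
proof (induction n)
  case (Suc n)
  have UW: "degree (U + W) \<le> d" using assms by (intro degree_add_le) auto
  have pow: "degree ((U + W) ^ m) \<le> d * m" for m
    using degree_power_le[of "U + W" m] mult_le_mono1[OF UW, of m] by (rule order.trans)
  have top: "coeff ((U + W) ^ m) (d * m) = coeff (U + W) d ^ m" for m
  proof (induction m)
    case (Suc m)
    have "coeff ((U + W) ^ Suc m) (d + d * m) = coeff (U + W) d * coeff ((U + W) ^ m) (d * m)"
      unfolding power_Suc by (rule coeff_mult_at_bounds[OF UW pow])
    then show ?case using Suc.IH by simp
  qed simp
  let ?E = "(U + W) ^ Suc n - U ^ Suc n"
  have eq: "(U + W) ^ Suc (Suc n) - U ^ Suc (Suc n) = ?E * U + (U + W) ^ Suc n * W"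
    by (simp add: algebra_simps)
  have d1: "degree (?E * U) \<le> d * Suc n + i"
    using Suc.IH U by (intro order.trans[OF degree_mult_le]) simp
  have d2: "degree ((U + W) ^ Suc n * W) \<le> d * Suc n + i"
    using pow[of "Suc n"] W by (intro order.trans[OF degree_mult_le]) simp
  have "coeff (?E * U) ((d * n + i) + d) = of_nat (Suc n) * coeff U d ^ n * coeff W i * coeff U d"
    using Suc.IH by (subst coeff_mult_at_bounds[OF _ U]) auto
  then have c1: "coeff (?E * U) (d * Suc n + i) = of_nat (Suc n) * coeff U d ^ Suc n * coeff W i"
    by (simp add: algebra_simps)
  have "coeff ((U + W) ^ Suc n * W) (d * Suc n + i) = coeff ((U + W) ^ Suc n) (d * Suc n) * coeff W i"
    by (rule coeff_mult_at_bounds[OF pow W])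
  also have "\<dots> = coeff (U + W) d ^ Suc n * coeff W i" by (simp only: top)
  finally have c2: "coeff ((U + W) ^ Suc n * W) (d * Suc n + i) = coeff (U + W) d ^ Suc n * coeff W i" .
  have "coeff W d = 0" using W assms(3) by (intro coeff_eq_0) simp
  then have "coeff ((U + W) ^ Suc (Suc n) - U ^ Suc (Suc n)) (d * Suc n + i)
      = of_nat (Suc (Suc n)) * coeff U d ^ Suc n * coeff W i"
    unfolding eq coeff_add c1 c2 by (simp add: algebra_simps)
  moreover have "degree ((U + W) ^ Suc (Suc n) - U ^ Suc (Suc n)) \<le> d * Suc n + i"
    unfolding eq using d1 d2 by (rule degree_add_le)
  ultimately show ?case by blast
qed (use W in simp)

lemma downward_induct:
  assumes "\<And>i. (\<And>l. l > i \<Longrightarrow> P l) \<Longrightarrow> P i" "\<And>l. l > n \<Longrightarrow> P l"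
  shows "P (i :: nat)"
proof (induction "Suc n - i" arbitrary: i rule: less_induct)
  case less
  show ?case
  proof (rule assms(1))
    fix l assume "l > i"
    then show "P l" using less[of l] assms(2)[of l] by (cases "l > n") auto
  qed
qed

lemma closed_ring_coeff_mult:
  assumes "closed_ring M" "\<And>i. coeff p i \<in> M" "\<And>i. coeff q i \<in> M"
  shows "coeff (p * q) i \<in> M"
  unfolding coeff_mult using assms by (intro closed_ring_sum closed_ringD(5)) auto

lemma closed_ring_coeff_power:
  assumes "closed_ring M" "\<And>i. coeff p i \<in> M"
  shows "coeff (p ^ n) i \<in> M"
proof (induction n arbitrary: i)
  case 0
  show ?case using closed_ringD(1,2)[OF assms(1)] by (simp add: coeff_1)
next
  case (Suc n)
  then show ?case using assms by (simp add: closed_ring_coeff_mult)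
qed

lemma closed_ring_of_nat: "closed_ring M \<Longrightarrow> of_nat n \<in> M"
  by (induction n) (auto intro: closed_ringD)

section \<open>Recovering the coefficients of a composition inside a subfield\<close>

definition closed_field :: "'k::field set \<Rightarrow> bool" where
  "closed_field M \<longleftrightarrow> closed_ring M \<and> (\<forall>x\<in>M. inverse x \<in> M)"

lemma closed_field_cancel:
  assumes "closed_field M" "c \<in> M" "c \<noteq> 0" "c * x \<in> M"
  shows "x \<in> M"
proof -
  have "inverse c * (c * x) \<in> M"
    using assms closed_ringD(5)[of M "inverse c" "c * x"] unfolding closed_field_def by blast
  then show ?thesis using assms(3) by (simp add: mult.assoc[symmetric])
qed

lemma coeff_pcompose: "coeff (pcompose h F) i = (\<Sum>l\<le>degree h. coeff h l * coeff (F ^ l) i)"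
  by (simp add: pcompose_altdef poly_altdef coeff_sum coeff_map_poly degree_map_poly mult.commute)

text \<open>Let \<open>d = degree F\<close> and \<open>degree h = k + 1\<close>. For
  \<open>0 < i < d\<close> only the top power of \<open>F\<close> reaches exponent
  \<open>d k + i\<close> in \<open>h(F)\<close>; there \<open>coeff F i\<close> enters linearly with
  factor \<open>k + 1\<close> times a power of the leading coefficient, next to higher coefficients
  of \<open>F\<close>. At \<open>i = 0\<close> the power \<open>F^k\<close> would interfere, so this
  coefficient is prescribed. With \<open>F\<close> known, the coefficients of \<open>h\<close>
  follow from the top as well.\<close>

lemma pcompose_coeffs_in_field:
  fixes F h :: "'k::field poly"
  assumes M: "closed_field M" and lc: "lead_coeff h \<in> M" "lead_coeff F \<in> M" and F0: "coeff F 0 = 0"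
    and comp: "\<And>i. coeff (pcompose h F) i \<in> M"
    and deg: "degree h > 0" "degree F > 0" and char: "of_nat (degree h) \<noteq> (0 :: 'k)"
  shows "coeff F i \<in> M" "coeff h i \<in> M"
proof -
  have R: "closed_ring M" using M by (simp add: closed_field_def)
  define d where "d = degree F"
  obtain k where k: "degree h = Suc k" using deg(1) by (cases "degree h") auto
  have d0: "d > 0" and F0': "coeff F d \<noteq> 0" and h0: "coeff h (Suc k) \<noteq> 0"
    using deg by (auto simp: d_def simp flip: k)
  have degpow: "degree (F ^ l) = d * l" for l
    using F0' by (subst degree_power_eq) (auto simp: d_def)
  show F: "coeff F i \<in> M" for i
  proof (rule downward_induct[of "\<lambda>i. coeff F i \<in> M" d])
    fix i assume IH: "\<And>l. l > i \<Longrightarrow> coeff F l \<in> M"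
    show "coeff F i \<in> M"
    proof (cases "i = 0 \<or> i \<ge> d")
      case True
      then show ?thesis
        using F0 lc(2) closed_ringD(1)[OF R] by (cases "i = d") (auto simp: d_def coeff_eq_0)
    next
      case False
      \<comment> \<open>\<open>U\<close> collects the terms of \<open>F\<close> above
        \<open>i\<close>, which are known by induction; \<open>W\<close> is the rest, and only its
        coefficient at \<open>i\<close> affects the exponent in question.\<close>
      define U where "U = F - poly_cutoff (Suc i) F"
      define W where "W = poly_cutoff (Suc i) F"
      have F_eq: "F = U + W" by (simp add: U_def W_def)
      have coeffU: "coeff U l = (if l > i then coeff F l else 0)" for l
        by (auto simp: U_def coeff_poly_cutoff)
      have U: "degree U \<le> d"
        by (rule degree_le) (auto simp: coeffU d_def coeff_eq_0)
      have W: "degree W \<le> i" by (rule degree_le) (auto simp: W_def coeff_poly_cutoff)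
      have UM: "coeff U l \<in> M" for l using IH closed_ringD(1)[OF R] by (simp add: coeffU)
      have *: "coeff (pcompose h F) (d * k + i) = coeff h (Suc k) * coeff (F ^ Suc k) (d * k + i)"
      proof -
        have "coeff (F ^ l) (d * k + i) = 0" if "l \<le> k" for l
          using that False by (intro coeff_eq_0) (auto simp: degpow intro: le_less_trans[OF mult_le_mono2])
        then show ?thesis unfolding coeff_pcompose k by (simp add: sum.neutral)
      qed
      have "coeff h (Suc k) * coeff (F ^ Suc k) (d * k + i) \<in> M"
        using comp[of "d * k + i"] by (simp only: *)
      then have "coeff (F ^ Suc k) (d * k + i) \<in> M"
        using closed_field_cancel[OF M _ h0] lc(1) k by simp
      then have "coeff (F ^ Suc k) (d * k + i) - coeff (U ^ Suc k) (d * k + i) \<in> M"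
        using closed_ring_coeff_power[OF R UM] by (rule closed_ringD(4)[OF R])
      also have "coeff (F ^ Suc k) (d * k + i) - coeff (U ^ Suc k) (d * k + i)
          = (of_nat (Suc k) * coeff U d ^ k) * coeff W i"
        using power_add_minus_power_top[OF U W, of k] False by (simp add: F_eq)
      finally have "coeff W i \<in> M"
      proof (rule closed_field_cancel[OF M, rotated 2])
        show "of_nat (Suc k) * coeff U d ^ k \<in> M"
          using UM closed_ring_of_nat[OF R] by (intro closed_ringD(5)[OF R] closed_ring_power[OF R])
        show "of_nat (Suc k) * coeff U d ^ k \<noteq> 0"
          using char F0' False by (simp only: k coeffU mult_eq_0_iff) simp
      qed
      then show ?thesis by (simp add: W_def coeff_poly_cutoff)
    qed
  next
    fix l assume "l > d"
    then show "coeff F l \<in> M" using closed_ringD(1)[OF R] by (simp add: d_def coeff_eq_0)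
  qed
  show "coeff h i \<in> M"
  proof (rule downward_induct[of "\<lambda>i. coeff h i \<in> M" "degree h"])
    fix i assume IH: "\<And>l. l > i \<Longrightarrow> coeff h l \<in> M"
    show "coeff h i \<in> M"
    proof (cases "i > degree h")
      case False
      \<comment> \<open>The powers of \<open>F\<close> below the \<open>i\<close>-th do not reach
        exponent \<open>d * i\<close>, so \<open>coeff h i\<close> is the only unknown
        there.\<close>
      let ?t = "\<lambda>l. coeff h l * coeff (F ^ l) (d * i)"
      have "(\<Sum>l\<le>degree h. ?t l) = (\<Sum>l\<in>{i..degree h}. ?t l)"
        using d0 by (intro sum.mono_neutral_right) (auto simp: degpow coeff_eq_0)
      also have "\<dots> = ?t i + (\<Sum>l\<in>{Suc i..degree h}. ?t l)"
        using False by (simp add: sum.atLeast_Suc_atMost)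
      finally have eq: "?t i = coeff (pcompose h F) (d * i) - (\<Sum>l\<in>{Suc i..degree h}. ?t l)"
        by (simp add: coeff_pcompose)
      have "?t i \<in> M"
        unfolding eq using IH by (intro closed_ringD(4,5)[OF R] comp closed_ring_sum[OF R]
          closed_ring_coeff_power[OF R F]) auto
      moreover have "coeff (F ^ i) (d * i) = coeff F d ^ i"
        using lead_coeff_power[of F i] by (simp only: degpow d_def)
      ultimately have "coeff F d ^ i * coeff h i \<in> M" by (simp add: mult.commute)
      then show ?thesis
        by (rule closed_field_cancel[OF M closed_ring_power[OF R F], rotated]) (use F0' in simp)
    qed (use closed_ringD(1)[OF R] in \<open>simp add: coeff_eq_0\<close>)
  next
    fix l assume "l > degree h"
    then show "coeff h l \<in> M" using closed_ringD(1)[OF R] by (simp add: coeff_eq_0)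
  qed
qed

section \<open>The subfields of fractions in a subset of the variables\<close>

definition fracs_in :: "'v set \<Rightarrow> ('v::linorder, 'a::idom) mpoly fract set" where
  "fracs_in V = {to_fract a / to_fract b | a b. a \<in> polys_in V \<and> b \<in> polys_in V \<and> b \<noteq> 0}"

lemma to_fract_in_fracs_in: "a \<in> polys_in V \<Longrightarrow> to_fract a \<in> fracs_in V"
  unfolding fracs_in_def by (force intro: exI[of _ "1 :: ('a, 'b) mpoly"])

lemma closed_field_fracs_in: "closed_field (fracs_in V)"
proof -
  have ring: "x + y \<in> fracs_in V \<and> x - y \<in> fracs_in V \<and> x * y \<in> fracs_in V"
    if xy: "x \<in> fracs_in V" "y \<in> fracs_in V" for x y :: "('a, 'b) mpoly fract"
  proof -
    obtain a b where x: "x = to_fract a / to_fract b" "a \<in> polys_in V" "b \<in> polys_in V" "b \<noteq> 0"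
      using xy(1) by (auto simp: fracs_in_def)
    obtain c d where y: "y = to_fract c / to_fract d" "c \<in> polys_in V" "d \<in> polys_in V" "d \<noteq> 0"
      using xy(2) by (auto simp: fracs_in_def)
    have bd: "b * d \<in> polys_in V" "b * d \<noteq> 0" using x y by (auto intro: polys_in_mult)
    have "x + y = to_fract (a * d + c * b) / to_fract (b * d)"
      "x - y = to_fract (a * d - c * b) / to_fract (b * d)"
      "x * y = to_fract (a * c) / to_fract (b * d)"
      using x(4) y(4) unfolding x(1) y(1) by (simp_all add: add_frac_eq diff_frac_eq)
    moreover have "a * d + c * b \<in> polys_in V" "a * d - c * b \<in> polys_in V" "a * c \<in> polys_in V"
      using x y by (auto intro: polys_in_add polys_in_diff polys_in_mult)
    ultimately show ?thesis using bd unfolding fracs_in_def by blast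
  qed
  have inv: "inverse x \<in> fracs_in V" if x: "x \<in> fracs_in V" for x :: "('a, 'b) mpoly fract"
  proof -
    obtain a b where x: "x = to_fract a / to_fract b" "a \<in> polys_in V" "b \<in> polys_in V" "b \<noteq> 0"
      using x by (auto simp: fracs_in_def)
    show ?thesis
    proof (cases "a = 0")
      case True
      then show ?thesis using x to_fract_in_fracs_in[of 0 V] by simp
    next
      case False
      have "inverse x = to_fract b / to_fract a" by (simp add: x)
      then show ?thesis using x False unfolding fracs_in_def by blast
    qed
  qed
  show ?thesis
    using ring inv to_fract_in_fracs_in[of 0 V] to_fract_in_fracs_in[of 1 V]
    by (simp add: closed_field_def closed_ring_def)
qed

text \<open>If \<open>x = a / b\<close>, then a nonzero \<open>x\<close> divides \<open>a\<close>,
  and divisors of nonzero elements of \<open>polys_in V\<close> lie there too.\<close>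

lemma to_fract_in_fracs_inD:
  fixes x :: "('v::{finite,linorder}, 'a::field) mpoly"
  assumes "to_fract x \<in> fracs_in V"
  shows "x \<in> polys_in V"
proof -
  obtain a b where x: "to_fract x = to_fract a / to_fract b" "a \<in> polys_in V" "b \<noteq> 0"
    using assms by (auto simp: fracs_in_def)
  then have "to_fract (x * b) = to_fract a" by (simp add: field_simps)
  then have a: "x * b = a" unfolding to_fract_eq_iff .
  show ?thesis
  proof (cases "x = 0")
    case False
    then show ?thesis using polys_in_dvd[of x a V] x a by auto
  qed simp
qed

text \<open>From \<open>a / b = c / d\<close> the denominator \<open>b\<close> divides
  \<open>d a\<close>, hence \<open>a\<close> by coprimality. So \<open>x\<close> is a polynomial,
  and it lies in both subrings, which meet in the constants.\<close>

lemma fracs_in_Int: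
  fixes x :: "('v::{finite,linorder}, 'a::field) mpoly fract"
  assumes "x \<in> fracs_in V" "x \<in> fracs_in W" "V \<inter> W = {}"
  shows "\<exists>c. x = to_fract (mconst c)"
proof -
  obtain a b where x: "x = to_fract a / to_fract b" "a \<in> polys_in V" "b \<in> polys_in V" "b \<noteq> 0"
    using assms(1) by (auto simp: fracs_in_def)
  obtain c d where y: "x = to_fract c / to_fract d" "c \<in> polys_in W" "d \<in> polys_in W" "d \<noteq> 0"
    using assms(2) by (auto simp: fracs_in_def)
  have "to_fract a / to_fract b = to_fract c / to_fract d" using x(1) y(1) by simp
  then have "to_fract (d * a) = to_fract (b * c)" using x(4) y(4) by (simp add: field_simps)
  then have "d * a = b * c" unfolding to_fract_eq_iff .
  then have "b dvd d * a" by (rule dvdI)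
  then have "b dvd a" by (rule dvd_cancel_disjoint[OF x(3) y(3) assms(3) y(4)])
  then obtain r where r: "a = b * r" by (elim dvdE)
  have xr: "x = to_fract r" using x(1,4) r by simp
  have "r \<in> polys_in V" "r \<in> polys_in W"
    using assms(1,2) unfolding xr by (auto dest: to_fract_in_fracs_inD)
  then have "r \<in> range mconst"
    using polys_in_Int[of V W] assms(3) polys_in_empty by auto
  then show ?thesis using xr by blast
qed

section \<open>Descent of the generator\<close>

text \<open>Here \<open>a / b\<close> is the \<open>k\<close>-th power of \<open>u1 / u2\<close>.
  Shifting the variables in \<open>Y\<close> and taking leading coefficients keeps \<open>a\<close>,
  makes \<open>b\<close> a constant \<open>\<beta>\<close> and yields
  \<open>r1^k \<beta> = r2^k a\<close>. Integral closedness gives that \<open>r2\<close> divides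
  \<open>r1\<close>, and \<open>r\<close> is the quotient.\<close>

lemma power_ratio_split_half:
  fixes u1 u2 a b :: "('v::{finite,linorder}, 'a::field) mpoly"
  assumes eq: "u1 ^ k * b = u2 ^ k * a" and k: "k > 0" and nz: "u1 \<noteq> 0" "u2 \<noteq> 0" "b \<noteq> 0"
    and a: "a \<in> polys_in X" and b: "b \<in> polys_in Y" and XY: "X \<inter> Y = {}" "X \<union> Y = UNIV"
  obtains r \<beta> where "r \<in> polys_in X" "\<beta> dvd 1" "a = \<beta> * r ^ k"
proof -
  have XYc: "UNIV - Y = X" using XY by auto
  have fin: "finite (Poly_Mapping.keys u1 \<union> Poly_Mapping.keys u2 \<union> Poly_Mapping.keys b)" by simp
  obtain w where w: "\<And>v. w v > 0" "lead_coeff (shift Y w u1) \<in> polys_in (UNIV - Y)"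
      "lead_coeff (shift Y w b) \<in> polys_in (Y - Y)"
  proof (rule exists_shift[OF fin, of Y])
    fix w :: "'v \<Rightarrow> nat"
    assume w: "\<And>v. w v > 0" "\<And>(u :: ('v, 'a) mpoly) W. Poly_Mapping.keys u \<subseteq>
        Poly_Mapping.keys u1 \<union> Poly_Mapping.keys u2 \<union> Poly_Mapping.keys b \<Longrightarrow>
        u \<in> polys_in W \<Longrightarrow> lead_coeff (shift Y w u) \<in> polys_in (W - Y)"
    show thesis
      by (rule that[OF w(1) w(2)[of u1 UNIV] w(2)[of b Y, OF _ b]]) (auto simp: polys_in_def)
  qed
  define r1 where "r1 = lead_coeff (shift Y w u1)"
  define r2 where "r2 = lead_coeff (shift Y w u2)"
  define \<beta> where "\<beta> = lead_coeff (shift Y w b)"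
  have nz': "r1 \<noteq> 0" "r2 \<noteq> 0" "\<beta> \<noteq> 0"
    using nz w(1) by (simp_all add: r1_def r2_def \<beta>_def shift_eq_0_iff)
  have unit: "\<beta> dvd 1" using w(3) nz' by (simp add: dvd_1_iff polys_in_empty \<beta>_def)
  have "shift Y w (u1 ^ k * b) = shift Y w (u2 ^ k * a)" by (simp only: eq)
  then have "shift Y w u1 ^ k * shift Y w b = shift Y w u2 ^ k * [:a:]"
    by (simp only: shift.eval_mult shift.eval_power shift_disjoint[OF a XY(1)])
  then have "lead_coeff (shift Y w u1 ^ k * shift Y w b) = lead_coeff (shift Y w u2 ^ k * [:a:])" by (rule arg_cong)
  then have r: "r1 ^ k * \<beta> = r2 ^ k * a"
    by (simp only: lead_coeff_mult lead_coeff_power r1_def r2_def \<beta>_def) simp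
  then have "r2 ^ k dvd \<beta> * r1 ^ k" by (simp add: mult.commute)
  with unit have "r2 ^ k dvd r1 ^ k" by (rule dvd_cancel_unit)
  then have "r2 dvd r1" using k by (rule mpoly_power_dvd_powerD)
  then obtain r where r1: "r1 = r2 * r" by (elim dvdE)
  show thesis
  proof (rule that)
    have "r dvd r1" by (simp add: r1)
    then show "r \<in> polys_in X"
      using w(2) nz'(1) polys_in_dvd[of r r1 X] by (simp add: XYc r1_def)
    have "r2 ^ k * a = r2 ^ k * (\<beta> * r ^ k)"
      unfolding r[symmetric] r1 by (simp add: power_mult_distrib mult_ac)
    then show "a = \<beta> * r ^ k" using nz' by simp
  qed (fact unit)
qed

text \<open>Both halves together give \<open>a = \<beta> r^k\<close> and
  \<open>b = \<alpha> q^k\<close>, so \<open>u1 q\<close> and \<open>u2 r\<close> have equal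
  \<open>k\<close>-th powers up to units and differ by a unit \<open>\<xi>\<close>. Coprimality
  makes \<open>r\<close> divide \<open>u1\<close>, and \<open>g\<close> is the cofactor;
  \<open>\<xi>\<close> is absorbed into \<open>q\<close>.\<close>

lemma power_ratio_split:
  fixes u1 u2 a b :: "('v::{finite,linorder}, 'a::field) mpoly"
  assumes eq: "u1 ^ k * b = u2 ^ k * a" and k: "k > 0" and nz: "u1 \<noteq> 0" "u2 \<noteq> 0" "a \<noteq> 0" "b \<noteq> 0"
    and a: "a \<in> polys_in X" and b: "b \<in> polys_in Y" and XY: "X \<inter> Y = {}" "X \<union> Y = UNIV"
  obtains g r q \<beta> where "u1 = r * g" "u2 = q * g" "r \<in> polys_in X" "q \<in> polys_in Y"
    "\<beta> \<in> range mconst" "a = \<beta> * r ^ k"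
proof -
  obtain r \<beta> where r: "r \<in> polys_in X" "\<beta> dvd 1" "a = \<beta> * r ^ k"
    using power_ratio_split_half[OF eq k nz(1,2,4) a b XY] .
  have YX: "Y \<inter> X = {}" "Y \<union> X = UNIV" using XY by auto
  obtain q \<alpha> where q: "q \<in> polys_in Y" "\<alpha> dvd 1" "b = \<alpha> * q ^ k"
    using power_ratio_split_half[OF eq[symmetric] k nz(2,1,3) b a YX] .
  have nz': "r \<noteq> 0" "q \<noteq> 0" using nz r(3) q(3) k by (auto simp: power_0_left)
  have eq': "(u1 * q) ^ k * \<alpha> = \<beta> * (u2 * r) ^ k"
    using eq unfolding r(3) q(3) by (simp add: power_mult_distrib mult_ac)
  then have "(u1 * q) ^ k dvd \<beta> * (u2 * r) ^ k" by (metis dvd_triv_left)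
  with r(2) have "(u1 * q) ^ k dvd (u2 * r) ^ k" by (rule dvd_cancel_unit)
  then have "u1 * q dvd u2 * r" using k by (rule mpoly_power_dvd_powerD)
  then obtain \<xi> where \<xi>: "u2 * r = u1 * q * \<xi>" by (elim dvdE)
  have "(u1 * q) ^ k * \<alpha> = (u1 * q) ^ k * (\<beta> * \<xi> ^ k)"
    unfolding eq' \<xi> by (simp add: power_mult_distrib mult_ac)
  then have "\<alpha> = \<beta> * \<xi> ^ k" using nz nz' by simp
  then have "\<xi> dvd \<alpha>" using k by (simp add: dvd_power)
  then have "\<xi> dvd 1" using q(2) by (rule dvd_trans)
  then have \<xi>': "\<xi> \<in> polys_in Y" "\<xi> \<noteq> 0" by (auto simp: dvd_1_iff)
  have "r dvd (q * \<xi>) * u1" using \<xi> by (metis dvd_triv_right mult.assoc mult.commute)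
  then have "r dvd u1"
    by (rule dvd_cancel_disjoint[OF r(1) polys_in_mult[OF q(1) \<xi>'(1)] XY(1), rotated]) (use nz' \<xi>' in simp)
  then obtain g where g: "u1 = r * g" by (elim dvdE)
  show thesis
  proof (rule that)
    show "u1 = r * g" by (fact g)
    have "r * u2 = r * (q * \<xi> * g)" using \<xi> by (simp add: g mult_ac)
    then show "u2 = (q * \<xi>) * g" using nz' by simp
    show "q * \<xi> \<in> polys_in Y" using q(1) \<xi>'(1) by (rule polys_in_mult)
    show "\<beta> \<in> range mconst" using r(2) by (simp add: dvd_1_iff)
  qed (use r in auto)
qed

section \<open>Rescaled compositions over the fraction field\<close>

lemma coeff_pcompose_linear: "coeff (pcompose h [:0, c:]) l = coeff h l * c ^ l"
  for c :: "'r::comm_semiring_1"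
proof (induction h arbitrary: l)
  case (pCons a h)
  then show ?case by (cases l) (auto simp: pcompose_pCons mult_ac)
qed simp

lemma fract_poly_pcompose:
  "map_poly to_fract (pcompose h F) = pcompose (map_poly to_fract h) (map_poly to_fract F)"
  by (induction h) (auto simp: pcompose_pCons map_poly_pCons fract_poly_mult)

lemma of_nat_fract_mpoly_neq_0:
  assumes "n > 0"
  shows "of_nat n \<noteq> (0 :: ('v::linorder, 'a::field_char_0) mpoly fract)"
proof -
  have "of_nat n = (to_fract (of_nat n) :: ('v, 'a) mpoly fract)"
    by (induction n) auto
  then show ?thesis using assms by (simp add: of_nat_eq_0_iff)
qed

text \<open>The \<open>\<eta> l\<close> are the coefficients of \<open>h(\<gamma> z)\<close>. Since
  these are constants and the top one is a unit, \<open>f = h(F)\<close> is an integral equation for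
  \<open>F / \<gamma>\<close>; multiplying by a power of \<open>\<gamma>\<close> clears the
  denominators.\<close>

lemma homogenized_pcompose_dvd:
  fixes \<gamma> :: "('v::{finite,linorder}, 'a::field) mpoly"
  assumes h: "map_poly to_fract f = pcompose h (map_poly to_fract F)"
    and \<eta>: "\<And>l. coeff h l * to_fract \<gamma> ^ l = to_fract (mconst (\<eta> l))"
    and deg: "degree h > 0" and \<gamma>: "\<gamma> \<noteq> 0"
  shows "[:\<gamma>:] dvd F"
proof (rule homogenized_root_dvd[OF _ _ \<gamma> deg, where e = "\<lambda>l. mconst (\<eta> l)" and B = f])
  let ?k = "degree h" and ?f = "map_poly to_fract"
  have "?f (\<Sum>l\<le>?k. [:mconst (\<eta> l) * \<gamma> ^ (?k - l):] * F ^ l)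
      = (\<Sum>l\<le>?k. smult (to_fract (mconst (\<eta> l) * \<gamma> ^ (?k - l))) (?f F ^ l))"
  proof -
    have "?f (sum G A) = (\<Sum>l\<in>A. ?f (G l))" for A and G :: "nat \<Rightarrow> ('v, 'a) mpoly poly"
      by (induction A rule: infinite_finite_induct) auto
    then show ?thesis by (simp add: fract_poly_power)
  qed
  also have "\<dots> = (\<Sum>l\<le>?k. smult (to_fract \<gamma> ^ ?k) (smult (coeff h l) (?f F ^ l)))"
  proof (intro sum.cong refl)
    fix l assume "l \<in> {..?k}"
    then have "to_fract \<gamma> ^ l * to_fract \<gamma> ^ (?k - l) = to_fract \<gamma> ^ ?k"
      by (simp flip: power_add)
    then have "to_fract (mconst (\<eta> l) * \<gamma> ^ (?k - l)) = to_fract \<gamma> ^ ?k * coeff h l"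
      by (simp add: to_fract_power mult_ac flip: \<eta>)
    then show "smult (to_fract (mconst (\<eta> l) * \<gamma> ^ (?k - l))) (?f F ^ l)
      = smult (to_fract \<gamma> ^ ?k) (smult (coeff h l) (?f F ^ l))" by simp
  qed
  also have "\<dots> = smult (to_fract \<gamma> ^ ?k) (pcompose h (?f F))"
    by (intro poly_eqI) (simp add: coeff_sum coeff_pcompose sum_distrib_left mult.assoc)
  also have "\<dots> = ?f ([:\<gamma> ^ ?k:] * f)"
    by (simp add: to_fract_power h)
  finally show "(\<Sum>l\<le>?k. [:mconst (\<eta> l) * \<gamma> ^ (?k - l):] * F ^ l) = [:\<gamma> ^ ?k:] * f"
    unfolding fract_poly_eq_iff .
  have "to_fract (mconst (\<eta> ?k) :: ('v, 'a) mpoly) \<noteq> 0"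
    unfolding \<eta>[symmetric] using deg \<gamma> by auto
  then show "(mconst (\<eta> ?k) :: ('v, 'a) mpoly) dvd 1"
    by (simp add: dvd_1_iff)
qed

text \<open>Replacing \<open>h\<close> and \<open>F\<close> by \<open>h(\<gamma> z)\<close> and
  \<open>F / \<gamma>\<close> leaves the composition unchanged and moves both leading coefficients
  into the subfield, where the recursive determination of coefficients applies.\<close>

lemma rescaled_coeffs_in:
  fixes F f :: "('v::{finite,linorder}, 'a::field_char_0) mpoly poly"
  assumes h: "map_poly to_fract f = pcompose h (map_poly to_fract F)"
    and deg: "degree h > 0" "degree F > 0" and F0: "coeff F 0 = 0"
    and f: "\<And>i. coeff f i \<in> polys_in V"
    and r: "lead_coeff F = r * \<gamma>" "r \<in> polys_in V"
    and lc: "lead_coeff h * to_fract \<gamma> ^ degree h \<in> fracs_in V"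
  shows "coeff h l * to_fract \<gamma> ^ l \<in> fracs_in V" "to_fract (coeff F i) * inverse (to_fract \<gamma>) \<in> fracs_in V"
proof -
  have \<gamma>: "\<gamma> \<noteq> 0" using r deg(2) by auto
  define F' where "F' = smult (inverse (to_fract \<gamma>)) (map_poly to_fract F)"
  define h' where "h' = pcompose h [:0, to_fract \<gamma>:]"
  have h': "coeff h' l = coeff h l * to_fract \<gamma> ^ l" for l
    by (simp add: h'_def coeff_pcompose_linear)
  have degh': "degree h' = degree h"
    using \<gamma> by (simp add: h'_def degree_pcompose)
  have F': "coeff F' i = to_fract (coeff F i) * inverse (to_fract \<gamma>)" for i
    by (simp add: F'_def coeff_map_poly)
  have degF': "degree F' = degree F"
    using \<gamma> by (simp add: F'_def degree_map_poly)
  have comp: "pcompose h' F' = map_poly to_fract f"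
  proof -
    have "pcompose [:0, to_fract \<gamma>:] F' = map_poly to_fract F"
      using \<gamma> by (simp add: pcompose_pCons F'_def)
    then show ?thesis by (simp add: h h'_def flip: pcompose_assoc)
  qed
  have *: "coeff F' i \<in> fracs_in V" "coeff h' l \<in> fracs_in V" for i l
  proof -
    have 1: "lead_coeff h' \<in> fracs_in V" using lc by (simp add: degh' h')
    have "to_fract r = lead_coeff F'" using r(1) \<gamma> by (simp add: degF' F')
    then have 2: "lead_coeff F' \<in> fracs_in V" using to_fract_in_fracs_in[OF r(2)] by simp
    have 3: "coeff F' 0 = 0" using F0 by (simp add: F')
    have 4: "coeff (pcompose h' F') i \<in> fracs_in V" for i
      unfolding comp using f[of i] by (simp add: coeff_map_poly to_fract_in_fracs_in)
    have 5: "degree h' > 0" "degree F' > 0" using deg by (simp_all add: degh' degF')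
    have 6: "of_nat (degree h') \<noteq> (0 :: ('v, 'a) mpoly fract)"
      using 5(1) by (rule of_nat_fract_mpoly_neq_0)
    show "coeff F' i \<in> fracs_in V" "coeff h' l \<in> fracs_in V"
      by (fact pcompose_coeffs_in_field[OF closed_field_fracs_in 1 2 3 4 5 6])+
  qed
  show "coeff h l * to_fract \<gamma> ^ l \<in> fracs_in V" "to_fract (coeff F i) * inverse (to_fract \<gamma>) \<in> fracs_in V"
    using *(2)[of l] *(1)[of i] by (simp_all add: h' F')
qed

lemma generator_descends:
  fixes F G f g :: "('v::{finite,linorder}, 'a::field_char_0) mpoly poly"
  assumes XY: "X \<inter> Y = {}" "X \<union> Y = UNIV"
    and f: "\<And>i. coeff f i \<in> polys_in X" "degree f > 0"
    and g: "\<And>i. coeff g i \<in> polys_in Y" "degree g > 0"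
    and hF: "map_poly to_fract f = pcompose h (map_poly to_fract F)"
    and hG: "map_poly to_fract g = pcompose h (map_poly to_fract G)"
    and F0: "coeff F 0 = 0" and G0: "coeff G 0 = 0"
    and no_factor: "\<And>d. d \<notin> range mconst \<Longrightarrow> \<not> ([:d:] dvd F \<and> [:d:] dvd G)"
  shows "coeff F i \<in> polys_in X" "coeff G i \<in> polys_in Y"
    "\<exists>h0. h = map_poly (\<lambda>c. to_fract (mconst c)) h0"
proof -
  let ?f = "map_poly to_fract"
  have df: "degree f = degree h * degree F"
    using arg_cong[OF hF, of degree] by (simp add: degree_map_poly degree_pcompose)
  have dg: "degree g = degree h * degree G"
    using arg_cong[OF hG, of degree] by (simp add: degree_map_poly degree_pcompose)
  have deg: "degree h > 0" "degree F > 0" "degree G > 0" using df dg f g by auto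
  define k where "k = degree h"
  have lf: "to_fract (lead_coeff f) = lead_coeff h * to_fract (lead_coeff F) ^ k"
    using arg_cong[OF hF, of lead_coeff] deg
    by (subst (asm) lead_coeff_comp) (simp_all add: degree_map_poly coeff_map_poly k_def)
  have lg: "to_fract (lead_coeff g) = lead_coeff h * to_fract (lead_coeff G) ^ k"
    using arg_cong[OF hG, of lead_coeff] deg
    by (subst (asm) lead_coeff_comp) (simp_all add: degree_map_poly coeff_map_poly k_def)
  \<comment> \<open>Both sides equal \<open>lead_coeff h\<close> times the \<open>k\<close>-th
    powers of the leading coefficients of \<open>F\<close> and \<open>G\<close>.\<close>
  have "to_fract (lead_coeff F ^ k * lead_coeff g) = to_fract (lead_coeff G ^ k * lead_coeff f)"
    by (simp only: to_fract_mult to_fract_power lf lg mult_ac)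
  then have eq: "lead_coeff F ^ k * lead_coeff g = lead_coeff G ^ k * lead_coeff f"
    unfolding to_fract_eq_iff .
  have "k > 0" "lead_coeff F \<noteq> 0" "lead_coeff G \<noteq> 0" "lead_coeff f \<noteq> 0" "lead_coeff g \<noteq> 0"
    using deg f g by (auto simp: k_def)
  from power_ratio_split[OF eq this f(1) g(1) XY]
  obtain \<gamma> r q \<beta> where r: "lead_coeff F = r * \<gamma>" "r \<in> polys_in X" and q: "lead_coeff G = q * \<gamma>" "q \<in> polys_in Y"
    and \<beta>: "\<beta> \<in> range mconst" "lead_coeff f = \<beta> * r ^ k" by metis
  have nz: "r \<noteq> 0" "\<gamma> \<noteq> 0" using r deg by auto
  \<comment> \<open>The top coefficient of \<open>h(\<gamma> z)\<close> is thus the constant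
    \<open>\<beta>\<close>, a starting value shared by the recursions for \<open>X\<close> and for
    \<open>Y\<close>.\<close>
  have "to_fract r ^ k * (lead_coeff h * to_fract \<gamma> ^ k) = to_fract r ^ k * to_fract \<beta>"
    using lf[symmetric] unfolding \<beta>(2) r(1)
    by (simp only: to_fract_mult to_fract_power power_mult_distrib mult_ac)
  then have lch: "lead_coeff h * to_fract \<gamma> ^ degree h = to_fract \<beta>"
    using nz by (simp add: k_def)
  have \<beta>': "to_fract \<beta> \<in> fracs_in V" for V
    using \<beta>(1) by (auto intro: to_fract_in_fracs_in)
  have X: "coeff h l * to_fract \<gamma> ^ l \<in> fracs_in X" "to_fract (coeff F i) * inverse (to_fract \<gamma>) \<in> fracs_in X" for l i
    using rescaled_coeffs_in[OF hF deg(1,2) F0 f(1) r] \<beta>' lch by simp_all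
  have Y: "coeff h l * to_fract \<gamma> ^ l \<in> fracs_in Y" "to_fract (coeff G i) * inverse (to_fract \<gamma>) \<in> fracs_in Y" for l i
    using rescaled_coeffs_in[OF hG deg(1,3) G0 g(1) q] \<beta>' lch by simp_all
  have "\<exists>c. coeff h l * to_fract \<gamma> ^ l = to_fract (mconst c)" for l
    using fracs_in_Int[OF X(1) Y(1) XY(1)] .
  then obtain \<eta> where \<eta>: "\<And>l. coeff h l * to_fract \<gamma> ^ l = to_fract (mconst (\<eta> l))" by metis
  \<comment> \<open>Integrality makes \<open>\<gamma>\<close> a common factor of \<open>F\<close>
    and \<open>G\<close>, hence a constant, and the rescaling can be undone within either
    subfield.\<close>
  have "[:\<gamma>:] dvd F" "[:\<gamma>:] dvd G"
    using homogenized_pcompose_dvd[OF hF \<eta> deg(1) nz(2)] homogenized_pcompose_dvd[OF hG \<eta> deg(1) nz(2)] .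
  then obtain c where c: "\<gamma> = mconst c" using no_factor by blast
  have c0: "c \<noteq> 0" using c nz by auto
  have inv: "inverse (to_fract \<gamma>) = to_fract (mconst (inverse c))"
  proof -
    have "to_fract (mconst (inverse c)) * to_fract \<gamma> = 1"
      using c0 unfolding c by (simp flip: to_fract_mult mconst_mult)
    then show ?thesis by (metis inverse_unique mult.commute)
  qed
  have scale: "x \<in> fracs_in V" if "x * inverse (to_fract \<gamma>) \<in> fracs_in V" for x V
  proof (rule closed_field_cancel[OF closed_field_fracs_in])
    show "inverse (to_fract \<gamma>) \<in> fracs_in V" unfolding inv by (intro to_fract_in_fracs_in) simp
    show "inverse (to_fract \<gamma>) \<noteq> 0" using nz by simp
    show "inverse (to_fract \<gamma>) * x \<in> fracs_in V" using that by (simp add: mult.commute)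
  qed
  show "coeff F i \<in> polys_in X" "coeff G i \<in> polys_in Y"
    using scale X(2) Y(2) by (blast intro: to_fract_in_fracs_inD)+
  have "coeff h l = to_fract (mconst (\<eta> l * inverse c ^ l))" for l
  proof -
    have "coeff h l = coeff h l * to_fract \<gamma> ^ l * inverse (to_fract \<gamma>) ^ l"
      using nz by (simp add: field_simps flip: power_mult_distrib)
    moreover have "mconst (inverse c ^ l) = (mconst (inverse c) :: ('v, 'a) mpoly) ^ l"
      by (induction l) (auto simp: mconst_mult)
    ultimately show ?thesis unfolding \<eta> inv by (simp add: mconst_mult to_fract_power)
  qed
  note * = this
  have "inj (\<lambda>c. to_fract (mconst c) :: ('v, 'a) mpoly fract)" by (auto intro: injI)
  note inv_f = inv_f_f[OF this]
  have "h = map_poly (\<lambda>c. to_fract (mconst c)) (map_poly (inv (\<lambda>c. to_fract (mconst c))) h)"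
  proof (rule poly_eqI)
    fix l
    have "inv (\<lambda>c. to_fract (mconst c)) (0 :: ('v, 'a) mpoly fract) = 0" using inv_f[of 0] by simp
    then show "coeff h l = coeff (map_poly (\<lambda>c. to_fract (mconst c)) (map_poly (inv (\<lambda>c. to_fract (mconst c))) h)) l"
      by (simp add: coeff_map_poly * inv_f)
  qed
  then show "\<exists>h0. h = map_poly (\<lambda>c. to_fract (mconst c)) h0" by blast
qed

section \<open>Transfer between pairs of polynomials and their homogenizations\<close>

theorem theorem7:
  fixes X Y :: "'v::{finite, linorder} set"
    and p :: "('v, 'a::field_char_0) mpoly"
    and I :: "('v, 'a) mpoly set"
    and P :: "('v, 'a) mpoly fract poly poly"
    and J :: "('v, 'a) mpoly fract poly poly set"
    and F G :: "('v, 'a) mpoly poly"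
  assumes vars: "X \<union> Y = UNIV" "X \<inter> Y = {}" "X \<noteq> {}" "Y \<noteq> {}"
    and p_mixed: "p \<notin> polys_in X \<union> polys_in Y"
    and p_zero: "mpoly_eval (\<lambda>c. c) (\<lambda>v. 0) p = 0"
    and I_def: "I = ideal_of {p}"
    and P_def: "P = phi X p"
    and J_def: "J = ideal_of {P}"
    and nontriv: "\<not> trivial_algebra (\<lambda>c. [:c:]) (alg_st J)"
    and gen: "generates_algebra (\<lambda>c. [:c:]) (alg_st J) (map_poly to_fract F, map_poly to_fract G)"
    and no_factor: "\<And>d. d \<notin> range mconst \<Longrightarrow> \<not> const_st d dvd (in_s F - in_t G)"
    and F_zero: "poly F 0 = 0"
    and G_zero: "poly G 0 = 0"
  shows "(\<not> trivial_algebra mconst (alg_XY X Y I) \<longleftrightarrow>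
            (\<forall>i. coeff F i \<in> polys_in X) \<and> (\<forall>i. coeff G i \<in> polys_in Y) \<and> poly F 1 \<noteq> poly G 1) \<and>
         (\<not> trivial_algebra mconst (alg_XY X Y I) \<longrightarrow>
            generates_algebra mconst (alg_XY X Y I) (poly F 1, poly G 1))"
proof -
  let ?D = "in_s F - in_t G" and ?B = "bihomog X p" and ?f = "map_poly to_fract"
  have P: "P = fract_poly2 ?B" unfolding P_def by (rule phi_eq_bihomog)
  have J: "J = {D. P dvd D}" and I: "I = {x. p dvd x}"
    unfolding J_def I_def by (simp_all add: ideal_of_singleton)
  have fract_st: "in_s (?f A) - in_t (?f B) = fract_poly2 (in_s A - in_t B)"
    for A B :: "('v, 'a) mpoly poly"
    by (intro poly_eqI) (simp add: in_s_def coeff_in_t coeff_map_poly coeff_pCons split: nat.splits)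
  \<comment> \<open>Since \<open>p\<close> is mixed, its bihomogenization involves both
    \<open>t\<close> and \<open>s\<close>; nontriviality then provides nonzero coefficients at
    \<open>s^0\<close> and at \<open>t^0\<close>, from which one can divide.\<close>
  obtain j1 where j1: "j1 > 0" "coeff ?B j1 \<noteq> 0"
    using bihomog_not_in_X[of p X] p_mixed by auto
  obtain i1 j2 where i1: "i1 > 0" "coeff (coeff ?B j2) i1 \<noteq> 0"
    using bihomog_not_in_Y[of p Y X] p_mixed vars(1) by auto
  have "coeff (coeff P j2) i1 \<noteq> 0"
    unfolding P coeff_fract_poly2 using i1(2) by simp
  moreover have "coeff P j1 \<noteq> 0"
    using j1(2) fract_poly_eq_iff[of "coeff ?B j1" 0] by (simp add: P coeff_map_poly)
  ultimately have "\<exists>j. coeff (coeff P j) 0 \<noteq> 0" "\<exists>i. coeff (coeff P 0) i \<noteq> 0"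
    using alg_st_nontrivial[OF nontriv[unfolded J] _ i1(1) _ j1(1)] by blast+
  then have col: "\<exists>j. coeff (coeff ?B j) 0 \<noteq> 0" and row: "coeff ?B 0 \<noteq> 0"
    unfolding P coeff_fract_poly2 by auto
  have descend: "?B dvd D" if "P dvd fract_poly2 D" for D
    using that unfolding P
    by (rule fract_poly2_dvdD[OF _ coeff_bihomog_0_in_polys_in row
        coeff_0_bihomog_in_polys_in[OF vars(1)] col vars(2)])
  have "(?f F, ?f G) \<in> alg_st J" using gen by (simp add: generates_algebra_def)
  then have "?B dvd ?D"
    by (intro descend) (simp add: alg_st_def J fract_st)
  then obtain Q where "?D = ?B * Q" by (elim dvdE)
  \<comment> \<open>The quotient \<open>Q\<close> has coefficients in \<open>R\<close>, so
    \<open>s = t = 1\<close> can be substituted within the polynomial ring.\<close>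
  then have "poly (poly ?D 1) 1 = p * poly (poly Q 1) 1"
    by (simp add: poly_bihomog_1)
  moreover have "poly (poly (in_t G) 1) 1 = poly G 1"
  proof -
    have "poly (in_t G) 1 = [:poly G 1:]"
      by (induction G) (simp_all add: in_t_def map_poly_pCons)
    then show ?thesis by simp
  qed
  ultimately have p_dvd: "p dvd poly F 1 - poly G 1"
    by (simp add: in_s_def)
  have pair: "(f = g \<and> f \<in> range mconst) \<or> (f \<notin> range mconst \<and> g \<notin> range mconst)"
    and pair_st: "(?f (homog f), ?f (homog g)) \<in> alg_st J"
    if fg: "(f, g) \<in> alg_XY X Y I" for f g
  proof -
    have f: "f \<in> polys_in X" and g: "g \<in> polys_in Y" and "p dvd f - g"
      using fg by (auto simp: alg_XY_def I)
    then obtain q where "f - g = p * q" by (elim dvdE)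
    then have "bihomog X f - bihomog X g = ?B * bihomog X q"
      by (simp flip: bihomog.eval_mult bihomog_diff)
    then have dvd: "?B dvd in_s (homog f) - in_t (homog g)"
      by (simp add: bihomog_in_s[OF f] bihomog_in_t[OF g vars(2)])
    then obtain R where "in_s (homog f) - in_t (homog g) = ?B * R" by (elim dvdE)
    then show "(?f (homog f), ?f (homog g)) \<in> alg_st J"
      by (simp add: alg_st_def J fract_st P fract_poly2_mult)
    have const: "homog (mconst c) = [:mconst c :: ('v, 'a) mpoly:]" for c
      by (rule poly_eqI) (auto simp: coeff_homog mconst_def coeff_pCons split: nat.splits)
    have const_st: "in_s [:c:] = in_t [:c :: ('v, 'a) mpoly:]" for c
      by (simp add: in_s_def in_t_def map_poly_pCons)
    \<comment> \<open>With \<open>f\<close> constant the homogenized difference depends on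
      \<open>t\<close> alone, while its divisor \<open>?B\<close> involves \<open>s\<close>; hence
      the difference is zero.\<close>
    have "g = mconst c" if "f = mconst c" for c
    proof -
      have "?B dvd in_t ([:mconst c:] - homog g)"
        using dvd unfolding that by (simp add: const const_st in_t_diff)
      then have "[:mconst c:] - homog g = 0" using i1(2,1) by (rule in_t_multiple_eq_0)
      then have "homog g = [:mconst c:]" by simp
      then show ?thesis using poly_homog_1[of g] by simp
    qed
    moreover have "f = mconst c" if "g = mconst c" for c
    proof -
      have "?B dvd in_s (homog f - [:mconst c:])"
        using dvd unfolding that by (simp add: const const_st in_s_diff)
      then have "homog f - [:mconst c:] = 0" using j1(2,1) by (rule in_s_multiple_eq_0)
      then have "homog f = [:mconst c:]" by simp
      then show ?thesis using poly_homog_1[of f] by simp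
    qed
    ultimately show "(f = g \<and> f \<in> range mconst) \<or> (f \<notin> range mconst \<and> g \<notin> range mconst)"
      by blast
  qed
  have lift: "(\<forall>i. coeff F i \<in> polys_in X) \<and> (\<forall>i. coeff G i \<in> polys_in Y) \<and>
      (\<exists>h0. f = poly (map_poly mconst h0) (poly F 1) \<and> g = poly (map_poly mconst h0) (poly G 1))"
    if fg: "(f, g) \<in> alg_XY X Y I" and nc: "f \<notin> range mconst" "g \<notin> range mconst" for f g
  proof -
    have f: "f \<in> polys_in X" and g: "g \<in> polys_in Y" using fg by (auto simp: alg_XY_def)
    \<comment> \<open>The generator supplies one \<open>h\<close> for both components, with
      coefficients a priori in the fraction field.\<close>
    obtain h where hF: "?f (homog f) = pcompose h (?f F)" and hG: "?f (homog g) = pcompose h (?f G)"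
      using gen pair_st[OF fg] by (fastforce simp: generates_algebra_def pcompose_altdef)
    have deg: "degree (homog f) > 0" "degree (homog g) > 0"
      using nc degree_homog_eq_0D by blast+
    have "\<not> ([:d:] dvd F \<and> [:d:] dvd G)" if "d \<notin> range mconst" for d
    proof
      assume "[:d:] dvd F \<and> [:d:] dvd G"
      then obtain F' G' where FG': "F = [:d:] * F'" "G = [:d:] * G'" by (auto elim!: dvdE)
      have "in_s F = const_st d * in_s F'" "in_t G = const_st d * in_t G'"
        unfolding FG' in_s_simps in_t_simps by (simp_all add: in_s_def in_t_def const_st_def map_poly_pCons)
      then have "const_st d dvd in_s F - in_t G" by (metis dvd_diff dvd_triv_left)
      then show False using no_factor[OF that] by contradiction
    qed
    note desc = generator_descends[OF vars(2,1) coeff_homog_in[OF f] deg(1) coeff_homog_in[OF g] deg(2)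
        hF hG _ _ this]
    have 0: "coeff F 0 = 0" "coeff G 0 = 0" using F_zero G_zero by (simp_all add: poly_0_coeff_0)
    obtain h0 where h0: "h = map_poly (\<lambda>c. to_fract (mconst c)) h0" using desc(3)[OF 0] by blast
    have h: "h = ?f (map_poly mconst h0)" unfolding h0 by (simp add: map_poly_map_poly o_def)
    \<comment> \<open>With constant coefficients in \<open>h\<close>, both compositions are
      identities over \<open>R\<close> and can be specialized at 1.\<close>
    have "homog f = pcompose (map_poly mconst h0) F" "homog g = pcompose (map_poly mconst h0) G"
      using hF hG unfolding h fract_poly_pcompose[symmetric] fract_poly_eq_iff .
    then have "f = poly (map_poly mconst h0) (poly F 1)" "g = poly (map_poly mconst h0) (poly G 1)"
      by (metis poly_homog_1 poly_pcompose)+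
    then show ?thesis using desc(1,2)[OF 0] by blast
  qed
  have forward: "(\<forall>i. coeff F i \<in> polys_in X) \<and> (\<forall>i. coeff G i \<in> polys_in Y) \<and> poly F 1 \<noteq> poly G 1"
    if nt: "\<not> trivial_algebra mconst (alg_XY X Y I)"
  proof -
    obtain f g where fg: "(f, g) \<in> alg_XY X Y I" "\<And>c. \<not> (f = mconst c \<and> g = mconst c)"
      using nt by (auto simp: trivial_algebra_def)
    have nc: "f \<notin> range mconst" "g \<notin> range mconst"
      using pair[OF fg(1)] fg(2) by blast+
    note l = lift[OF fg(1) nc]
    \<comment> \<open>Equal values would give \<open>f = g\<close>, an element of both
      \<open>polys_in X\<close> and \<open>polys_in Y\<close>, hence a constant.\<close>
    have "poly F 1 \<noteq> poly G 1"
    proof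
      assume "poly F 1 = poly G 1"
      then have "f = g" using l by metis
      moreover have "f \<in> polys_in X" "g \<in> polys_in Y" using fg(1) by (auto simp: alg_XY_def)
      ultimately have "f \<in> polys_in (X \<inter> Y)" using polys_in_Int[of X Y] by blast
      then show False using nc(1) by (simp add: vars(2) polys_in_empty)
    qed
    then show ?thesis using l by blast
  qed
  have in_alg: "(poly F 1, poly G 1) \<in> alg_XY X Y I"
    if "\<forall>i. coeff F i \<in> polys_in X" "\<forall>i. coeff G i \<in> polys_in Y"
    using that p_dvd by (simp add: alg_XY_def I poly_in_polys_in)
  have "generates_algebra mconst (alg_XY X Y I) (poly F 1, poly G 1)"
    if "\<not> trivial_algebra mconst (alg_XY X Y I)"
    unfolding generates_algebra_def
  proof (intro conjI ballI)
    show "(poly F 1, poly G 1) \<in> alg_XY X Y I" using forward[OF that] in_alg by blast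
    fix w assume w: "w \<in> alg_XY X Y I"
    obtain f g where fg: "w = (f, g)" by (cases w)
    \<comment> \<open>Constant pairs come from constant polynomials \<open>h0\<close>; all other
      pairs are covered by \<open>lift\<close>.\<close>
    have "\<exists>h0. f = poly (map_poly mconst h0) (poly F 1) \<and> g = poly (map_poly mconst h0) (poly G 1)"
    proof (cases "f \<in> range mconst")
      case True
      then obtain c where "f = mconst c" "g = mconst c" using pair[of f g] w fg by auto
      then show ?thesis by (intro exI[of _ "[:c:]"]) (simp add: map_poly_pCons)
    next
      case False
      then show ?thesis using pair[of f g] lift[of f g] w fg by blast
    qed
    then show "\<exists>h. w = (poly (map_poly mconst h) (fst (poly F 1, poly G 1)),
        poly (map_poly mconst h) (snd (poly F 1, poly G 1)))"
      by (simp add: fg)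
  qed
  \<comment> \<open>Pairs in a trivial algebra have equal components, unlike the pair of values at
    1.\<close>
  moreover have "\<not> trivial_algebra mconst (alg_XY X Y I)"
    if "\<forall>i. coeff F i \<in> polys_in X" "\<forall>i. coeff G i \<in> polys_in Y" "poly F 1 \<noteq> poly G 1"
  proof
    assume "trivial_algebra mconst (alg_XY X Y I)"
    then show False using in_alg[OF that(1,2)] that(3) by (auto simp: trivial_algebra_def)
  qed
  ultimately show ?thesis using forward by blast
qed

end
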